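(* Let $X=\mathbb{R}^d$ with Borel $\sigma$-algebra $\mathcal{A}$, let $\mathbb{V},\mathbb{W}$ be Banach spaces over $\mathbb{F}\in\{\mathbb{R},\mathbb{C}\}$, and let $h\in X$. Let $\mu:\mathcal{A}\to L(\mathbb{V},\mathbb{W})$ be countably additive in the operator norm, Fomin differentiable along $h$ in the semivariation topology $\mathscr{T}_{sv}$ (i.e. $\mu\in\mathcal{D}[L(\mathbb{V},\mathbb{W}),\mathscr{T}_{sv},h]$), with continuous semivariation $\widehat{\mu}$. Let $\varphi:X\to L(\mathbb{V})$ be a function whose directional derivative $\partial_h\varphi(x)=\lim_{t\to0}(\varphi(x+th)-\varphi(x))/t$ exists for every $x\in X$, and suppose $\varphi,\partial_h\varphi\in\mathcal{BSM}[\mathcal{A},L(\mathbb{V})]$. Then $\mu\varphi\in\mathcal{D}[L(\mathbb{V},\mathbb{W}),\mathscr{T}_{sv},h]$ and $$\partial_h(\mu\varphi)=\partial_h\mu\cdot\varphi+\mu\cdot\partial_h\varphi .$$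
   Context: $L(\mathbb{V},\mathbb{W})$ is the space of bounded linear operators with the operator norm, $L(\mathbb{V})=L(\mathbb{V},\mathbb{V})$. $\mathrm{CA}[\mathcal{A},Y]$ is the set of $Y$-valued measures on $\mathcal{A}$ countably additive in the norm of $Y$. Semivariation: for $\mu\in\mathrm{CA}[\mathcal{A},L(\mathbb{V},\mathbb{W})]$, $\widehat{\mu}(A)=\sup\{\|\sum_{i=1}^m\mu(A_i)v_i\|_{\mathbb{W}}: A_i\in\mathcal{A}\text{ disjoint, finitely many, contained in }A,\ \|v_i\|\le1\}$. It is continuous if $A_n\searrow\varnothing$ in $\mathcal{A}$ implies $\widehat{\mu}(A_n)\to0$; this implies $\widehat\mu(X)<\infty$. Put $\|\mu\|_{sv}=\widehat{\mu}(X)$ (possibly $+\infty$); $\mathscr{T}_{sv}$ is the topology induced by $\|\cdot\|_{sv}$. Fomin differentiability: for $x\in X$ let $\mu_x(A)=\mu(A+x)$. $\mu\in\mathcal{D}[L(\mathbb{V},\mathbb{W}),\mathscr{T}_{sv},h]$ means that the map $T_\mu: X\ni x\mapsto\mu_x\in(\mathrm{CA}[\mathcal{A},L(\mathbb{V},\mathbb{W})],\mathscr{T}_{sv})$ is differentiable along $h$ at every point. The Fomin derivative $\partial_h\mu\in \mathrm{CA}[\mathcal{A},L(\mathbb{V},\mathbb{W})]$ is the derivative of $T_\mu$ along $h$ at $0$, i.e. $\partial_h\mu=\lim_{t\to0}(\mu_{th}-\mu)/t$. $\mathcal{BSM}[\mathcal{A},Y]$ is the set of bounded functions $X\to Y$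 that are pointwise limits of sequences of $\mathcal{A}$-measurable functions with finitely many values. Dobrakov integral: for a countably additive operator-valued measure $m:\mathcal{A}\to L(E,G)$ ($E,G$ Banach) of finite semivariation and a simple function $s=\sum_i\chi_{A_i}v_i$ ($A_i\in\mathcal A$ disjoint, $v_i\in E$), $\int_As\,dm=\sum_i m(A\cap A_i)v_i$. A function $f:X\to E$ is Dobrakov integrable if there are simple $s_n\to f$ almost everywhere (outside a set of zero semivariation) such that $\lim_n\int_As_n\,dm$ exists in $G$ for every $A\in\mathcal{A}$; then $\int_Af\,dm$ is this limit (independent of the sequence). Product of a measure and an operator-valued function: for $\mu\in\mathrm{CA}[\mathcal{A},L(\mathbb{V},\mathbb{W})]$ with continuous semivariation, let $M:\mathcal{A}\to L[L(\mathbb{V}),L(\mathbb{V},\mathbb{W})]$, $M(A)[F]=\mu(A)\circ F$. For $\varphi\in\mathcal{BSM}[\mathcal{A},L(\mathbb{V})]$ (automatically $M$-integrable), $\mu\varphi=\mu\cdot\varphi$ is the measure $A\mapsto\int_A\varphi\,dM\in L(\mathbb{V},\mathbb{W})$. The same notation is used with $\partial_h\mu$ (whose semivariation is again continuous) in place of $\mu$. *)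

theory Defs
  imports "HOL-Analysis.Analysis"
begin

text \<open>
  The scalar field is a set \<open>K\<close> of complex numbers, either \<open>\<real>\<close> or \<open>UNIV\<close>.  A normed space
  over \<open>K\<close> is a real normed space with a scalar multiplication by \<open>K\<close> extending the real one
  (values of \<open>scale\<close> outside \<open>K\<close> are irrelevant).
\<close>

locale normed_space_over =
  fixes K :: "complex set" and scale :: "complex \<Rightarrow> 'a::real_normed_vector \<Rightarrow> 'a"
  assumes scalar_field: "K = \<real> \<or> K = UNIV"
    and scale_right_distrib: "c \<in> K \<Longrightarrow> scale c (x + y) = scale c x + scale c y"
    and scale_left_distrib: "c \<in> K \<Longrightarrow> d \<in> K \<Longrightarrow> scale (c + d) x = scale c x + scale d x"
    and scale_scale: "c \<in> K \<Longrightarrow> d \<in> K \<Longrightarrow> scale c (scale d x) = scale (c * d) x"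
    and scale_of_real: "scale (of_real r) x = r *\<^sub>R x"
    and norm_scale: "c \<in> K \<Longrightarrow> norm (scale c x) = cmod c * norm x"

text \<open>
  \<open>L(V, W)\<close>: the bounded \<open>K\<close>-linear operators, as a closed subspace of the bounded real-linear
  ones (with the same operator norm).
\<close>

definition bounded_ops ::
  "complex set \<Rightarrow> (complex \<Rightarrow> 'v \<Rightarrow> 'v) \<Rightarrow> (complex \<Rightarrow> 'w \<Rightarrow> 'w)
    \<Rightarrow> ('v::real_normed_vector \<Rightarrow>\<^sub>L 'w::real_normed_vector) set" where
  "bounded_ops K sV sW =
    {T. \<forall>c\<in>K. \<forall>v. blinfun_apply T (sV c v) = sW c (blinfun_apply T v)}"

lemma normed_space_over_real: "normed_space_over \<real> (\<lambda>c x. Re c *\<^sub>R x)"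
  by unfold_locales
    (auto elim!: Reals_cases simp: scaleR_add_right scaleR_add_left norm_mult simp flip: of_real_add of_real_mult)

lemma normed_space_over_complex: "normed_space_over UNIV ((*) :: complex \<Rightarrow> complex \<Rightarrow> complex)"
  by unfold_locales (auto simp: algebra_simps norm_mult scaleR_conv_of_real)

lemma bounded_ops_real:
  assumes "normed_space_over \<real> sV" "normed_space_over \<real> sW"
  shows "bounded_ops \<real> sV sW = UNIV"
  using normed_space_over.scale_of_real[OF assms(1)] normed_space_over.scale_of_real[OF assms(2)]
  by (auto simp: bounded_ops_def blinfun.scaleR_right elim!: Reals_cases)

text \<open>
  Measures on the sigma-algebra \<open>sets M\<close> are represented by functions that vanish outside
  \<open>sets M\<close>, so that equality of measures is equality of functions.
\<close>

definition CA :: "'x measure \<Rightarrow> 'y::real_normed_vector set \<Rightarrow> ('x set \<Rightarrow> 'y) set" where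
  "CA M Y = {\<mu>. (\<forall>A\<in>sets M. \<mu> A \<in> Y) \<and> (\<forall>A. A \<notin> sets M \<longrightarrow> \<mu> A = 0) \<and>
     (\<forall>F. range F \<subseteq> sets M \<longrightarrow> disjoint_family F \<longrightarrow>
        (\<lambda>n::nat. \<mu> (F n)) sums \<mu> (\<Union>n. F n))}"

text \<open>
  In the next definitions \<open>m\<close> is an operator-valued measure whose values are operators with
  domain \<open>E\<close>, a closed subspace of the type \<open>'e\<close>; only the values \<open>m A v\<close> with \<open>v \<in> E\<close> matter.
\<close>

definition semivariation ::
  "'x measure \<Rightarrow> 'e::real_normed_vector set \<Rightarrow> ('x set \<Rightarrow> 'e \<Rightarrow> 'g::real_normed_vector)
    \<Rightarrow> 'x set \<Rightarrow> ennreal" where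
  "semivariation M E m A =
    Sup {ennreal (norm (\<Sum>i<n. m (B i) (v i))) | (n::nat) B v.
      (\<forall>i<n. B i \<in> sets M \<and> B i \<subseteq> A) \<and> disjoint_family_on B {..<n} \<and>
      (\<forall>i<n. v i \<in> E \<and> norm (v i) \<le> 1)}"

definition continuous_semivariation ::
  "'x measure \<Rightarrow> 'e::real_normed_vector set \<Rightarrow> ('x set \<Rightarrow> 'e \<Rightarrow> 'g::real_normed_vector) \<Rightarrow> bool"
  where
  "continuous_semivariation M E m \<longleftrightarrow>
    (\<forall>A::nat \<Rightarrow> 'x set. range A \<subseteq> sets M \<longrightarrow> decseq A \<longrightarrow> (\<Inter>n. A n) = {} \<longrightarrow>
      (\<lambda>n. semivariation M E m (A n)) \<longlonglongrightarrow> 0)"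

definition simple_integral_op ::
  "'x measure \<Rightarrow> ('x set \<Rightarrow> 'e \<Rightarrow> 'g::real_normed_vector) \<Rightarrow> 'x set \<Rightarrow> ('x \<Rightarrow> 'e) \<Rightarrow> 'g" where
  "simple_integral_op M m A s = (\<Sum>v\<in>s ` space M. m (A \<inter> (s -` {v} \<inter> space M)) v)"

definition dobrakov_approx ::
  "'x measure \<Rightarrow> 'e::real_normed_vector set \<Rightarrow> ('x set \<Rightarrow> 'e \<Rightarrow> 'g::real_normed_vector)
    \<Rightarrow> ('x \<Rightarrow> 'e) \<Rightarrow> (nat \<Rightarrow> 'x \<Rightarrow> 'e) \<Rightarrow> bool" where
  "dobrakov_approx M E m f s \<longleftrightarrow>
    (\<forall>n. simple_function M (s n) \<and> s n ` space M \<subseteq> E) \<and>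
    (\<exists>N\<in>sets M. semivariation M E m N = 0 \<and> (\<forall>x\<in>space M - N. (\<lambda>n. s n x) \<longlonglongrightarrow> f x)) \<and>
    (\<forall>A\<in>sets M. convergent (\<lambda>n. simple_integral_op M m A (s n)))"

definition dobrakov_integrable ::
  "'x measure \<Rightarrow> 'e::real_normed_vector set \<Rightarrow> ('x set \<Rightarrow> 'e \<Rightarrow> 'g::real_normed_vector)
    \<Rightarrow> ('x \<Rightarrow> 'e) \<Rightarrow> bool" where
  "dobrakov_integrable M E m f \<longleftrightarrow> f ` space M \<subseteq> E \<and> (\<exists>s. dobrakov_approx M E m f s)"

definition dobrakov_integral ::
  "'x measure \<Rightarrow> 'e::real_normed_vector set \<Rightarrow> ('x set \<Rightarrow> 'e \<Rightarrow> 'g::real_normed_vector)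
    \<Rightarrow> 'x set \<Rightarrow> ('x \<Rightarrow> 'e) \<Rightarrow> 'g" where
  "dobrakov_integral M E m A f =
    (THE I. dobrakov_integrable M E m f \<and>
      (\<exists>s. dobrakov_approx M E m f s \<and> (\<lambda>n. simple_integral_op M m A (s n)) \<longlonglongrightarrow> I))"

definition BSM :: "'x measure \<Rightarrow> 'y::real_normed_vector set \<Rightarrow> ('x \<Rightarrow> 'y) set" where
  "BSM M Y = {f. f ` space M \<subseteq> Y \<and> bounded (f ` space M) \<and>
    (\<exists>s::nat \<Rightarrow> 'x \<Rightarrow> 'y. (\<forall>n. simple_function M (s n) \<and> s n ` space M \<subseteq> Y) \<and>
      (\<forall>x\<in>space M. (\<lambda>n. s n x) \<longlonglongrightarrow> f x))}"

text \<open>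
  The product \<open>\<mu>\<phi>\<close>, where \<open>LV\<close> is the space \<open>L(V)\<close> in which \<open>\<phi>\<close> takes its values; the integral is
  taken against the operator-valued measure \<open>A \<mapsto> (F \<mapsto> \<mu>(A) \<circ> F)\<close> with operators on \<open>LV\<close>.
\<close>

definition measure_mult ::
  "'x measure \<Rightarrow> ('v::real_normed_vector \<Rightarrow>\<^sub>L 'v) set \<Rightarrow>
    ('x set \<Rightarrow> 'v \<Rightarrow>\<^sub>L 'w::real_normed_vector) \<Rightarrow> ('x \<Rightarrow> 'v \<Rightarrow>\<^sub>L 'v) \<Rightarrow> 'x set \<Rightarrow> 'v \<Rightarrow>\<^sub>L 'w" where
  "measure_mult M LV \<mu> \<phi> A =
    (if A \<in> sets M then dobrakov_integral M LV (\<lambda>B F. \<mu> B o\<^sub>L F) A \<phi> else 0)"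

definition op_semivariation ::
  "'x measure \<Rightarrow> ('x set \<Rightarrow> 'v::real_normed_vector \<Rightarrow>\<^sub>L 'w::real_normed_vector) \<Rightarrow> 'x set \<Rightarrow> ennreal"
  where
  "op_semivariation M \<mu> = semivariation M UNIV (\<lambda>A. blinfun_apply (\<mu> A))"

definition sv_norm ::
  "'x measure \<Rightarrow> ('x set \<Rightarrow> 'v::real_normed_vector \<Rightarrow>\<^sub>L 'w::real_normed_vector) \<Rightarrow> ennreal" where
  "sv_norm M \<mu> = op_semivariation M \<mu> (space M)"

definition shift_measure :: "'x::ab_group_add \<Rightarrow> ('x set \<Rightarrow> 'y) \<Rightarrow> 'x set \<Rightarrow> 'y" where
  "shift_measure x \<mu> A = \<mu> ((\<lambda>y. y + x) ` A)"

text \<open>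
  \<open>\<nu>\<close> is the derivative along \<open>h\<close>, at the point \<open>x\<close>, of \<open>x \<mapsto> \<mu>\<^sub>x\<close> as a map into \<open>CA borel Y\<close> with
  the topology of \<open>sv_norm\<close> (an extended norm on that space).
\<close>

definition has_fomin_deriv_at ::
  "('v::real_normed_vector \<Rightarrow>\<^sub>L 'w::real_normed_vector) set \<Rightarrow> 'x::real_normed_vector \<Rightarrow> 'x \<Rightarrow>
    ('x set \<Rightarrow> 'v \<Rightarrow>\<^sub>L 'w) \<Rightarrow> ('x set \<Rightarrow> 'v \<Rightarrow>\<^sub>L 'w) \<Rightarrow> bool" where
  "has_fomin_deriv_at Y h x \<mu> \<nu> \<longleftrightarrow> \<nu> \<in> CA borel Y \<and>
    ((\<lambda>t::real. sv_norm borel (\<lambda>A.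
        (shift_measure (x + t *\<^sub>R h) \<mu> A - shift_measure x \<mu> A) /\<^sub>R t - \<nu> A)) \<longlongrightarrow> 0) (at 0)"

definition fomin_differentiable ::
  "('v::real_normed_vector \<Rightarrow>\<^sub>L 'w::real_normed_vector) set \<Rightarrow> 'x::real_normed_vector \<Rightarrow>
    ('x set \<Rightarrow> 'v \<Rightarrow>\<^sub>L 'w) set" where
  "fomin_differentiable Y h = {\<mu> \<in> CA borel Y. \<forall>x. \<exists>\<nu>. has_fomin_deriv_at Y h x \<mu> \<nu>}"

definition fomin_deriv ::
  "('v::real_normed_vector \<Rightarrow>\<^sub>L 'w::real_normed_vector) set \<Rightarrow> 'x::real_normed_vector \<Rightarrow>
    ('x set \<Rightarrow> 'v \<Rightarrow>\<^sub>L 'w) \<Rightarrow> 'x set \<Rightarrow> 'v \<Rightarrow>\<^sub>L 'w" where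
  "fomin_deriv Y h \<mu> = (THE \<nu>. has_fomin_deriv_at Y h 0 \<mu> \<nu>)"

definition has_dir_deriv ::
  "'x::real_normed_vector \<Rightarrow> ('x \<Rightarrow> 'y::real_normed_vector) \<Rightarrow> 'x \<Rightarrow> 'y \<Rightarrow> bool" where
  "has_dir_deriv h f x D \<longleftrightarrow> ((\<lambda>t::real. (f (x + t *\<^sub>R h) - f x) /\<^sub>R t) \<longlongrightarrow> D) (at 0)"

definition dir_deriv ::
  "'x::real_normed_vector \<Rightarrow> ('x \<Rightarrow> 'y::real_normed_vector) \<Rightarrow> 'x \<Rightarrow> 'y" where
  "dir_deriv h f x = (THE D. has_dir_deriv h f x D)"

end

theory Submission imports Defs begin

text \<open>
  The product rule rests on the identity
  \<open>((\<mu>\<phi>)\<^sub>t\<^sub>h - \<mu>\<phi>) / t - (\<partial>\<mu> \<phi> + \<mu> \<partial>\<phi>)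
    = ((\<mu>\<^sub>t\<^sub>h - \<mu>) / t - \<partial>\<mu>) \<phi>\<^sub>t\<^sub>h + \<partial>\<mu> (\<phi>\<^sub>t\<^sub>h - \<phi>) + \<mu> ((\<phi>\<^sub>t\<^sub>h - \<phi>) / t - \<partial>\<phi>)\<close>,
  where \<open>f\<^sub>t\<^sub>h\<close> is the translate by \<open>t h\<close>; it follows from bilinearity of the product and from its
  invariance under simultaneous translation of both factors.  The first term is at most
  \<open>sup \<parallel>\<phi>\<parallel>\<close> times the semivariation norm of \<open>(\<mu>\<^sub>t\<^sub>h - \<mu>) / t - \<partial>\<mu>\<close>
  (\<open>op_semivariation_measure_mult_le\<close>), which tends to \<open>0\<close> by hypothesis.  In the other two terms
  the functions tend to \<open>0\<close> pointwise and stay bounded, in the last one by the mean value theorem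
  along \<open>h\<close>; so these terms vanish by dominated convergence in the semivariation norm
  (\<open>measure_mult_dominated_convergence\<close>).  Dominated convergence needs continuity of the
  semivariation, which \<open>\<partial>\<mu>\<close> inherits as a limit of difference quotients in the semivariation
  norm (\<open>has_fomin_deriv_at_CCA\<close>).  The case of a general base point is the case of \<open>0\<close>, translated.

  Two facts about the Dobrakov integral precede this.  A continuous semivariation is finite
  (\<open>semivariation_finite\<close>), so that an Egorov type argument gives convergence of the integrals of a
  bounded pointwise convergent sequence of simple functions.  The integral does not depend on
  the approximating sequence (\<open>dobrakov_integral_eqI\<close>): the sequences admitted in the definition are
  only pointwise convergent with setwise convergent integrals, and a gliding hump replaces the
  missing domination.
\<close>

section \<open>A gliding hump\<close>

text \<open>
  Additive set functions that converge setwise, tend to zero uniformly inside each \<open>E k\<close>, and are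
  each small off \<open>E k\<close> for large \<open>k\<close>, have limit zero.  Mass that escaped along the sets \<open>E k\<close> would
  travel through the successive differences of a sparse subsequence, and the union of every second
  difference would see it only every other time.
\<close>

lemma gliding_hump:
  fixes \<nu> :: "nat \<Rightarrow> 'x set \<Rightarrow> 'g::real_normed_vector"
  assumes add: "\<And>n A B. A \<in> sets M \<Longrightarrow> B \<in> sets M \<Longrightarrow> A \<inter> B = {} \<Longrightarrow> \<nu> n (A \<union> B) = \<nu> n A + \<nu> n B"
    and E_sets: "\<And>k::nat. E k \<in> sets M" and E_mono: "incseq E"
    and inside: "\<And>k \<delta>. \<delta> > 0 \<Longrightarrow> \<exists>N. \<forall>n\<ge>N. \<forall>A\<in>sets M. A \<subseteq> E k \<longrightarrow> norm (\<nu> n A) < \<delta>"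
    and outside: "\<And>n \<delta>. \<delta> > 0 \<Longrightarrow> \<exists>k. \<forall>A\<in>sets M. A \<inter> E k = {} \<longrightarrow> norm (\<nu> n A) < \<delta>"
    and conv: "\<And>A. A \<in> sets M \<Longrightarrow> convergent (\<lambda>n. \<nu> n A)"
    and A: "A \<in> sets M"
  shows "(\<lambda>n. \<nu> n A) \<longlonglongrightarrow> 0"
proof -
  obtain l where l: "(\<lambda>n. \<nu> n A) \<longlonglongrightarrow> l"
    using conv[OF A] by (auto simp: convergent_def)
  have "l = 0"
  proof (rule ccontr)
    assume "l \<noteq> 0"
    define \<delta> where "\<delta> = norm l / 8"
    have \<delta>: "\<delta> > 0" using \<open>l \<noteq> 0\<close> by (simp add: \<delta>_def)
    obtain N0 where N0: "\<And>n. n \<ge> N0 \<Longrightarrow> norm (\<nu> n A - l) < \<delta>"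
      using LIMSEQ_D[OF l \<delta>] by blast
    \<comment> \<open>Indices \<open>n\<close> and \<open>k\<close> are chosen alternately: the \<open>j\<close>-th function lives, up to \<open>\<delta>\<close>, on the block
        between the \<open>k\<close> chosen at step \<open>j - 1\<close> and the \<open>k\<close> chosen at step \<open>j\<close>.\<close>
    define P where "P = (\<lambda>(n, k). n \<ge> N0 \<and> (\<forall>B\<in>sets M. B \<inter> E k = {} \<longrightarrow> norm (\<nu> n B) < \<delta>))"
    define Q where "Q = (\<lambda>(n::nat, k::nat) (n', k'::nat). n < n' \<and> k \<le> k' \<and>
        (\<forall>B\<in>sets M. B \<subseteq> E k \<longrightarrow> norm (\<nu> n' B) < \<delta>))"
    have "\<exists>f. \<forall>j::nat. P (f j) \<and> Q (f j) (f (Suc j))"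
    proof (rule dependent_nat_choice)
      obtain k where "\<forall>B\<in>sets M. B \<inter> E k = {} \<longrightarrow> norm (\<nu> N0 B) < \<delta>"
        using outside[OF \<delta>] by blast
      then show "\<exists>x. P x" by (auto simp: P_def)
    next
      fix x :: "nat \<times> nat" and j :: nat
      assume "P x"
      obtain n k where x: "x = (n, k)" by (cases x)
      obtain N where N: "\<And>n' B. n' \<ge> N \<Longrightarrow> B \<in> sets M \<Longrightarrow> B \<subseteq> E k \<Longrightarrow> norm (\<nu> n' B) < \<delta>"
        using inside[OF \<delta>, of k] by blast
      define n' where "n' = Max {Suc n, N, N0}"
      have n': "n' \<ge> Suc n" "n' \<ge> N" "n' \<ge> N0" by (auto simp: n'_def)
      obtain k' where k': "\<forall>B\<in>sets M. B \<inter> E k' = {} \<longrightarrow> norm (\<nu> n' B) < \<delta>"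
        using outside[OF \<delta>] by blast
      have "E k' \<subseteq> E (max k k')" using E_mono by (simp add: incseq_def)
      then have "P (n', max k k')" using k' n' by (auto simp: P_def)
      moreover have "Q x (n', max k k')" using n' N by (auto simp: Q_def x)
      ultimately show "\<exists>y. P y \<and> Q x y" by blast
    qed
    then obtain f where f: "\<And>j::nat. P (f j)" "\<And>j. Q (f j) (f (Suc j))" by blast
    define p where "p j = fst (f j)" for j
    define q where "q j = snd (f j)" for j
    have p_large: "p j \<ge> N0" and p_less: "p j < p (Suc j)" and q_le: "q j \<le> q (Suc j)"
      and off: "\<And>B. B \<in> sets M \<Longrightarrow> B \<inter> E (q j) = {} \<Longrightarrow> norm (\<nu> (p j) B) < \<delta>"
      and on: "\<And>B. B \<in> sets M \<Longrightarrow> B \<subseteq> E (q j) \<Longrightarrow> norm (\<nu> (p (Suc j)) B) < \<delta>" for j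
      using f(1)[of j] f(2)[of j] by (auto simp: P_def Q_def p_def q_def split: prod.splits)
    have p_mono: "strict_mono p" using p_less by (simp add: strict_mono_Suc_iff)
    have q_mono: "i \<le> j \<Longrightarrow> E (q i) \<subseteq> E (q j)" for i j
      using E_mono lift_Suc_mono_le[of q i j] q_le by (auto simp: incseq_def)
    \<comment> \<open>The odd blocks of \<open>A\<close>: functions with odd index see almost all their mass there, those with
        even index almost nothing.\<close>
    define T where "T = (\<Union>j. A \<inter> (E (q (2 * j + 1)) - E (q (2 * j))))"
    have T: "T \<in> sets M" using A E_sets by (auto simp: T_def)
    have T_A: "T \<subseteq> A" by (auto simp: T_def)
    have three: "\<nu> n S = \<nu> n (S \<inter> E a) + \<nu> n (S \<inter> (E b - E a)) + \<nu> n (S - E b)"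
      if "S \<in> sets M" "E a \<subseteq> E b" for n S a b
    proof -
      have "S = ((S \<inter> E a) \<union> (S \<inter> (E b - E a))) \<union> (S - E b)" using that by blast
      then have "\<nu> n S = \<nu> n (((S \<inter> E a) \<union> (S \<inter> (E b - E a))) \<union> (S - E b))" by simp
      also have "\<dots> = \<nu> n ((S \<inter> E a) \<union> (S \<inter> (E b - E a))) + \<nu> n (S - E b)"
        using that E_sets by (intro add) auto
      also have "\<nu> n ((S \<inter> E a) \<union> (S \<inter> (E b - E a))) = \<nu> n (S \<inter> E a) + \<nu> n (S \<inter> (E b - E a))"
        using that E_sets by (intro add) auto
      finally show ?thesis .
    qed
    have odd_block: "T \<inter> (E (q (2*j+1)) - E (q (2*j))) = A \<inter> (E (q (2*j+1)) - E (q (2*j)))" for j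
      by (auto simp: T_def)
    have even_block: "T \<inter> (E (q (2*j+2)) - E (q (2*j+1))) = {}" for j
    proof -
      have "x \<in> E (q (2*j+1)) \<or> x \<notin> E (q (2*j+2))" if "x \<in> E (q (2*i+1))" "x \<notin> E (q (2*i))" for x i
        using that q_mono[of "2*i+1" "2*j+1"] q_mono[of "2*j+2" "2*i"] by (cases "i \<le> j") auto
      then show ?thesis by (auto simp: T_def)
    qed
    have zero: "\<nu> n {} = 0" for n using add[of "{}" "{}" n] by simp
    have tri: "norm (a - b + c - d) \<le> norm a + norm b + norm c + norm d" for a b c d :: 'g
      using norm_triangle_ineq4[of a b] norm_triangle_ineq4[of "a - b + c" d]
        norm_triangle_ineq[of "a - b" c] by linarith
    have high: "norm (\<nu> (p (2*j+1)) T) \<ge> 3 * \<delta>" for j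
    proof -
      let ?n = "p (2*j+1)" let ?a = "q (2*j)" let ?b = "q (2*j+1)"
      have sub: "E ?a \<subseteq> E ?b" by (rule q_mono) simp
      have "norm (\<nu> ?n (T \<inter> E ?a)) < \<delta>" "norm (\<nu> ?n (A \<inter> E ?a)) < \<delta>"
        using on[of "_" "2*j"] T A E_sets by auto
      moreover have "norm (\<nu> ?n (T - E ?b)) < \<delta>" "norm (\<nu> ?n (A - E ?b)) < \<delta>"
        using off[of "_" "2*j+1"] T A E_sets by (auto intro!: off)
      moreover have "\<nu> ?n T - \<nu> ?n A = \<nu> ?n (T \<inter> E ?a) - \<nu> ?n (A \<inter> E ?a) + \<nu> ?n (T - E ?b) - \<nu> ?n (A - E ?b)"
        using three[OF T sub, of ?n] three[OF A sub, of ?n] odd_block[of j] by simp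
      ultimately have "norm (\<nu> ?n T - \<nu> ?n A) < 4 * \<delta>"
        using tri[of "\<nu> ?n (T \<inter> E ?a)" "\<nu> ?n (A \<inter> E ?a)" "\<nu> ?n (T - E ?b)" "\<nu> ?n (A - E ?b)"]
        by simp
      moreover have "norm (\<nu> ?n A - l) < \<delta>" using N0 p_large by blast
      moreover have "norm l = 8 * \<delta>" by (simp add: \<delta>_def)
      moreover have "norm l \<le> norm (\<nu> ?n T) + norm (\<nu> ?n T - \<nu> ?n A) + norm (\<nu> ?n A - l)"
        using norm_triangle_ineq4[of "\<nu> ?n T" "\<nu> ?n T - l"] norm_triangle_ineq[of "\<nu> ?n T - \<nu> ?n A" "\<nu> ?n A - l"]
        by simp
      ultimately show ?thesis by linarith
    qed
    have low: "norm (\<nu> (p (2*j+2)) T) \<le> 2 * \<delta>" for j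
    proof -
      let ?n = "p (2*j+2)" let ?a = "q (2*j+1)" let ?b = "q (2*j+2)"
      have sub: "E ?a \<subseteq> E ?b" by (rule q_mono) simp
      have "norm (\<nu> ?n (T \<inter> E ?a)) < \<delta>"
        using on[of "_" "2*j+1"] T E_sets by auto
      moreover have "norm (\<nu> ?n (T - E ?b)) < \<delta>"
        using T E_sets by (intro off) auto
      moreover have "\<nu> ?n T = \<nu> ?n (T \<inter> E ?a) + \<nu> ?n (T - E ?b)"
        using three[OF T sub, of ?n] even_block[of j] by (simp add: zero)
      ultimately show ?thesis
        using norm_triangle_ineq[of "\<nu> ?n (T \<inter> E ?a)" "\<nu> ?n (T - E ?b)"] by simp
    qed
    obtain L where L: "(\<lambda>n. norm (\<nu> n T)) \<longlonglongrightarrow> L"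
      using conv[OF T] tendsto_norm by (auto simp: convergent_def)
    have "strict_mono (\<lambda>j. p (2*j+1))" "strict_mono (\<lambda>j. p (2*j+2))"
      using p_mono by (auto simp: strict_mono_def)
    then have "(\<lambda>j. norm (\<nu> (p (2*j+1)) T)) \<longlonglongrightarrow> L" "(\<lambda>j. norm (\<nu> (p (2*j+2)) T)) \<longlonglongrightarrow> L"
      using LIMSEQ_subseq_LIMSEQ[OF L] by (auto simp: o_def)
    then have "3 * \<delta> \<le> L" "L \<le> 2 * \<delta>"
      using high low by (auto intro: LIMSEQ_le_const LIMSEQ_le_const2)
    then show False using \<delta> by simp
  qed
  then show ?thesis using l by simp
qed

section \<open>Semivariation\<close>

lemma semivariation_upper:
  assumes "finite I" "disjoint_family_on B I"
    and "\<And>i. i \<in> I \<Longrightarrow> B i \<in> sets M" "\<And>i. i \<in> I \<Longrightarrow> B i \<subseteq> A"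
    and "\<And>i. i \<in> I \<Longrightarrow> v i \<in> E" "\<And>i. i \<in> I \<Longrightarrow> norm (v i) \<le> 1"
  shows "ennreal (norm (\<Sum>i\<in>I. m (B i) (v i))) \<le> semivariation M E m A"
proof -
  obtain g where g: "bij_betw g {0..<card I} I"
    using ex_bij_betw_nat_finite[OF assms(1)] by blast
  have gI: "i < card I \<Longrightarrow> g i \<in> I" for i using g by (auto simp: bij_betw_def)
  have "(\<Sum>i\<in>I. m (B i) (v i)) = (\<Sum>i<card I. m (B (g i)) (v (g i)))"
    using sum.reindex_bij_betw[OF g, of "\<lambda>i. m (B i) (v i)"] by (simp add: atLeast0LessThan)
  moreover have "disjoint_family_on (\<lambda>i. B (g i)) {..<card I}"
    unfolding disjoint_family_on_def
  proof (intro ballI impI)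
    fix i j assume "i \<in> {..<card I}" "j \<in> {..<card I}" "i \<noteq> j"
    then have "g i \<in> I" "g j \<in> I" "g i \<noteq> g j"
      using g gI by (auto simp: bij_betw_def inj_on_def)
    then show "B (g i) \<inter> B (g j) = {}" using assms(2) by (simp add: disjoint_family_on_def)
  qed
  ultimately show ?thesis
    unfolding semivariation_def using assms(3-) gI
    by (intro Sup_upper CollectI exI[of _ "card I"] exI[of _ "\<lambda>i. B (g i)"] exI[of _ "\<lambda>i. v (g i)"]) auto
qed

lemma semivariation_least:
  assumes "\<And>(n::nat) B v. \<lbrakk>\<And>i. i < n \<Longrightarrow> B i \<in> sets M; \<And>i. i < n \<Longrightarrow> B i \<subseteq> A; disjoint_family_on B {..<n};
      \<And>i. i < n \<Longrightarrow> v i \<in> E; \<And>i. i < n \<Longrightarrow> norm (v i) \<le> 1\<rbrakk> \<Longrightarrow> ennreal (norm (\<Sum>i<n. m (B i) (v i))) \<le> c"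
  shows "semivariation M E m A \<le> c"
  unfolding semivariation_def by (rule Sup_least) (auto intro!: assms)

lemma semivariation_mono:
  assumes "A \<subseteq> B"
  shows "semivariation M E m A \<le> semivariation M E m B"
  using assms by (intro semivariation_least semivariation_upper) auto

text \<open>
  A finitely additive set function with operator values.  The operators are defined on the whole
  type, but the semivariation tests them only on the subspace \<open>E\<close>.
\<close>

locale additive_operator_measure =
  fixes M :: "'x measure" and E :: "'e::real_normed_vector set"
    and m :: "'x set \<Rightarrow> 'e \<Rightarrow> 'g::real_normed_vector"
  assumes subspace_E: "subspace E"
    and bounded_linear: "A \<in> sets M \<Longrightarrow> bounded_linear (m A)"
    and additive: "A \<in> sets M \<Longrightarrow> B \<in> sets M \<Longrightarrow> A \<inter> B = {} \<Longrightarrow> m (A \<union> B) v = m A v + m B v"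
begin

lemma empty: "m {} v = 0"
  using additive[of "{}" "{}" v] by simp

lemma zero: "A \<in> sets M \<Longrightarrow> m A 0 = 0"
  using bounded_linear by (rule linear_simps(3))

lemma additive_UN:
  assumes "finite I" "disjoint_family_on B I" "\<And>i. i \<in> I \<Longrightarrow> B i \<in> sets M"
  shows "m (\<Union>i\<in>I. B i) v = (\<Sum>i\<in>I. m (B i) v)"
  using assms
proof (induction I rule: finite_induct)
  case empty
  then show ?case by (simp add: additive_operator_measure.empty[OF additive_operator_measure_axioms])
next
  case (insert i I)
  have "m (B i \<union> (\<Union>i\<in>I. B i)) v = m (B i) v + m (\<Union>i\<in>I. B i) v"
    using insert.prems insert.hyps
    by (intro additive) (auto simp: disjoint_family_on_def)
  with insert show ?case by (simp add: disjoint_family_on_def)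
qed

lemma semivariation_scaled:
  assumes "finite I" "disjoint_family_on B I"
    and "\<And>i. i \<in> I \<Longrightarrow> B i \<in> sets M" "\<And>i. i \<in> I \<Longrightarrow> B i \<subseteq> A"
    and "\<And>i. i \<in> I \<Longrightarrow> v i \<in> E" "\<And>i. i \<in> I \<Longrightarrow> norm (v i) \<le> c" "c \<ge> 0"
  shows "ennreal (norm (\<Sum>i\<in>I. m (B i) (v i))) \<le> ennreal c * semivariation M E m A"
proof (cases "c = 0")
  case True
  then have "(\<Sum>i\<in>I. m (B i) (v i)) = 0"
    using assms zero by (intro sum.neutral) auto
  then show ?thesis by simp
next
  case False
  then have c: "c > 0" using assms by simp
  have "m (B i) (v i) = c *\<^sub>R m (B i) (v i /\<^sub>R c)" if "i \<in> I" for i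
    using linear_simps(5)[OF bounded_linear[OF assms(3)[OF that]], of c "v i /\<^sub>R c"] c by simp
  then have "norm (\<Sum>i\<in>I. m (B i) (v i)) = c * norm (\<Sum>i\<in>I. m (B i) (v i /\<^sub>R c))"
    using c by (simp add: scaleR_sum_right[symmetric])
  also have "ennreal \<dots> = ennreal c * ennreal (norm (\<Sum>i\<in>I. m (B i) (v i /\<^sub>R c)))"
    using c by (simp add: ennreal_mult)
  also have "\<dots> \<le> ennreal c * semivariation M E m A"
    using assms c subspace_E
    by (intro mult_left_mono semivariation_upper) (auto simp: subspace_scale field_simps)
  finally show ?thesis .
qed

lemma semivariation_Un:
  assumes "A \<in> sets M" "B \<in> sets M"
  shows "semivariation M E m (A \<union> B) \<le> semivariation M E m A + semivariation M E m B"
proof (rule semivariation_least)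
  fix n :: nat and C v
  assume C: "\<And>i. i < n \<Longrightarrow> C i \<in> sets M" "\<And>i. i < n \<Longrightarrow> C i \<subseteq> A \<union> B" "disjoint_family_on C {..<n}"
    and v: "\<And>i. i < n \<Longrightarrow> v i \<in> E" "\<And>i. i < n \<Longrightarrow> norm (v i) \<le> 1"
  have "m (C i) (v i) = m (C i \<inter> A) (v i) + m (C i - A) (v i)" if "i < n" for i
  proof -
    have "(C i \<inter> A) \<union> (C i - A) = C i" by blast
    moreover have "m ((C i \<inter> A) \<union> (C i - A)) (v i) = m (C i \<inter> A) (v i) + m (C i - A) (v i)"
      using C that assms by (intro additive) auto
    ultimately show ?thesis by simp
  qed
  then have "(\<Sum>i<n. m (C i) (v i)) = (\<Sum>i<n. m (C i \<inter> A) (v i)) + (\<Sum>i<n. m (C i - A) (v i))"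
    by (simp flip: sum.distrib)
  then have "ennreal (norm (\<Sum>i<n. m (C i) (v i)))
      \<le> ennreal (norm (\<Sum>i<n. m (C i \<inter> A) (v i)) + norm (\<Sum>i<n. m (C i - A) (v i)))"
    by (intro ennreal_leI) (simp add: norm_triangle_ineq)
  also have "\<dots> = ennreal (norm (\<Sum>i<n. m (C i \<inter> A) (v i))) + ennreal (norm (\<Sum>i<n. m (C i - A) (v i)))"
    by simp
  also have "\<dots> \<le> semivariation M E m A + semivariation M E m B"
    using C v assms
    by (intro add_mono semivariation_upper) (fastforce simp: disjoint_family_on_def)+
  finally show "ennreal (norm (\<Sum>i<n. m (C i) (v i))) \<le> semivariation M E m A + semivariation M E m B" .
qed

lemma semivariation_empty: "semivariation M E m {} = 0"
proof -
  have "semivariation M E m {} \<le> 0"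
    by (rule semivariation_least) (simp add: empty)
  then show ?thesis by simp
qed

lemma semivariation_UN_finite:
  assumes "finite I" "\<And>i. i \<in> I \<Longrightarrow> B i \<in> sets M" "\<And>i. i \<in> I \<Longrightarrow> semivariation M E m (B i) < \<infinity>"
  shows "semivariation M E m (\<Union>i\<in>I. B i) < \<infinity>"
  using assms
proof (induction I rule: finite_induct)
  case empty
  then show ?case by (simp add: semivariation_empty)
next
  case (insert i I)
  have "semivariation M E m (B i \<union> (\<Union>i\<in>I. B i)) \<le> semivariation M E m (B i) + semivariation M E m (\<Union>i\<in>I. B i)"
    using insert by (intro semivariation_Un) auto
  also have "\<dots> < \<infinity>" using insert by (simp add: ennreal_add_less_top)
  finally show ?case by simp
qed

text \<open>
  A set \<open>A\<close> of infinite semivariation contains a smaller such set whose complement in \<open>A\<close> is not small.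
  Otherwise, in a disjoint family inside \<open>A\<close> that yields a large sum, one piece \<open>B j\<close> would have infinite
  semivariation and its complement semivariation below \<open>1\<close>, so that the sum would differ by at most
  \<open>2\<close> from a value of \<open>m A\<close> on the unit ball; but \<open>m A\<close> is a bounded operator.
\<close>

lemma infinite_semivariation_split:
  assumes A: "A \<in> sets M" and inf: "semivariation M E m A = \<infinity>"
  shows "\<exists>A'\<in>sets M. A' \<subseteq> A \<and> semivariation M E m A' = \<infinity> \<and> 1 \<le> semivariation M E m (A - A')"
proof (rule ccontr)
  assume "\<not> ?thesis"
  then have small: "semivariation M E m (A - A') < 1"
    if "A' \<in> sets M" "A' \<subseteq> A" "semivariation M E m A' = \<infinity>" for A'
    using that by (meson not_le)
  obtain K where K: "\<And>v. norm (m A v) \<le> norm v * K" "K > 0"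
    using bounded_linear.pos_bounded[OF bounded_linear[OF A]] by blast
  have "ennreal (K + 2) < semivariation M E m A" using inf by simp
  then obtain n :: nat and B v where B: "\<And>i. i < n \<Longrightarrow> B i \<in> sets M" "\<And>i. i < n \<Longrightarrow> B i \<subseteq> A"
      "disjoint_family_on B {..<n}"
    and v: "\<And>i. i < n \<Longrightarrow> v i \<in> E" "\<And>i. i < n \<Longrightarrow> norm (v i) \<le> 1"
    and gt: "ennreal (K + 2) < ennreal (norm (\<Sum>i<n. m (B i) (v i)))"
    unfolding semivariation_def less_Sup_iff by blast
  have gt': "K + 2 < norm (\<Sum>i<n. m (B i) (v i))" using gt K(2) by (subst (asm) ennreal_less_iff) auto
  show False
  proof (cases "\<exists>j<n. semivariation M E m (B j) = \<infinity>")
    case False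
    define U where "U = (\<Union>i<n. B i)"
    have U: "U \<in> sets M" "U \<subseteq> A" using B by (auto simp: U_def)
    have "semivariation M E m U < \<infinity>"
      unfolding U_def using False B by (intro semivariation_UN_finite) (auto simp: top.not_eq_extremum)
    moreover have "semivariation M E m A \<le> semivariation M E m U + semivariation M E m (A - U)"
      using semivariation_Un[of U "A - U"] U A by (simp add: Un_absorb1)
    ultimately have "semivariation M E m (A - U) = \<infinity>"
      using inf by (auto simp: top_unique ennreal_add_eq_top)
    then have "semivariation M E m (A - (A - U)) < 1"
      using A U by (intro small) auto
    then have "semivariation M E m U < 1" using U by (simp add: double_diff)
    moreover have "ennreal (norm (\<Sum>i<n. m (B i) (v i))) \<le> semivariation M E m U"
      using B v by (intro semivariation_upper) (auto simp: U_def)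
    ultimately have "ennreal (norm (\<Sum>i<n. m (B i) (v i))) < 1" by (rule le_less_trans[rotated])
    then have "norm (\<Sum>i<n. m (B i) (v i)) < 1" by simp
    then show False using gt' K by simp
  next
    case True
    then obtain j where j: "j < n" "semivariation M E m (B j) = \<infinity>" by blast
    have lt: "semivariation M E m (A - B j) < ennreal 1" using small B j by simp
    have disj: "B i \<inter> B j = {}" if "i < n" "i \<noteq> j" for i
      using B(3) j that by (auto simp: disjoint_family_on_def)
    have "ennreal (norm (\<Sum>i\<in>{..<n} - {j}. m (B i) (v i))) \<le> semivariation M E m (A - B j)"
    proof (rule semivariation_upper)
      show "B i \<subseteq> A - B j" if "i \<in> {..<n} - {j}" for i
        using that B(2)[of i] disj[of i] by auto
      show "disjoint_family_on B ({..<n} - {j})"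
        by (rule disjoint_family_on_mono[OF _ B(3)]) auto
    qed (use B v in auto)
    with lt have "ennreal (norm (\<Sum>i\<in>{..<n} - {j}. m (B i) (v i))) < ennreal 1" by (rule le_less_trans[rotated])
    then have 1: "norm (\<Sum>i\<in>{..<n} - {j}. m (B i) (v i)) < 1" by (subst (asm) ennreal_less_iff) auto
    have "ennreal (norm (\<Sum>i\<in>{j}. m (A - B j) (v j))) \<le> semivariation M E m (A - B j)"
      using B v j A by (intro semivariation_upper) (auto simp: disjoint_family_on_def)
    with lt have "ennreal (norm (\<Sum>i\<in>{j}. m (A - B j) (v j))) < ennreal 1" by (rule le_less_trans[rotated])
    then have 2: "norm (m (A - B j) (v j)) < 1" by (subst (asm) ennreal_less_iff) auto
    have "m (B j \<union> (A - B j)) (v j) = m (B j) (v j) + m (A - B j) (v j)"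
      using A B j by (intro additive) auto
    then have 3: "m (B j) (v j) = m A (v j) - m (A - B j) (v j)"
      using B j by (simp add: Un_absorb1)
    have "norm (m A (v j)) \<le> K"
      using K(1)[of "v j"] v(2)[OF j(1)] K(2) mult_right_mono[of "norm (v j)" 1 K] by linarith
    moreover have "(\<Sum>i<n. m (B i) (v i)) = m A (v j) - m (A - B j) (v j) + (\<Sum>i\<in>{..<n} - {j}. m (B i) (v i))"
      using j by (simp add: sum.remove[of _ j] 3)
    ultimately have "norm (\<Sum>i<n. m (B i) (v i)) < K + 2"
      using 1 2 norm_triangle_ineq4[of "m A (v j)" "m (A - B j) (v j)"]
       norm_triangle_ineq[of "m A (v j) - m (A - B j) (v j)" "\<Sum>i\<in>{..<n} - {j}. m (B i) (v i)"] by simp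
    then show False using gt' by simp
  qed
qed

end

locale continuous_operator_measure = additive_operator_measure +
  assumes continuous: "continuous_semivariation M E m"
begin

lemma semivariation_decseq:
  assumes "\<And>n. A n \<in> sets M" "decseq A" "(\<Inter>n. A n) = {}"
  shows "(\<lambda>n. semivariation M E m (A n)) \<longlonglongrightarrow> 0"
  using continuous assms by (auto simp: continuous_semivariation_def)

text \<open>
  Iterating the splitting gives a decreasing sequence whose successive differences have
  semivariation at least \<open>1\<close>, against continuity.
\<close>

lemma semivariation_finite: "semivariation M E m A < \<infinity>"
proof -
  have "semivariation M E m (space M) < \<infinity>"
  proof (rule ccontr)
    assume "\<not> ?thesis"
    then have inf: "semivariation M E m (space M) = \<infinity>" by (simp add: less_top[symmetric])
    define P where "P A \<longleftrightarrow> A \<in> sets M \<and> semivariation M E m A = \<infinity>" for A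
    have "\<exists>f. \<forall>n::nat. P (f n) \<and> (f (Suc n) \<subseteq> f n \<and> 1 \<le> semivariation M E m (f n - f (Suc n)))"
      using inf infinite_semivariation_split
      by (intro dependent_nat_choice) (auto simp: P_def)
    then obtain f :: "nat \<Rightarrow> 'a set" where f: "\<And>n. f n \<in> sets M" "\<And>n. f (Suc n) \<subseteq> f n"
        "\<And>n. 1 \<le> semivariation M E m (f n - f (Suc n))"
      unfolding P_def by blast
    define D where "D n = f n - (\<Inter>k. f k)" for n
    have "decseq D" using f(2) by (fastforce simp: decseq_Suc_iff D_def)
    moreover have "(\<Inter>n. D n) = {}" by (auto simp: D_def)
    moreover have "D n \<in> sets M" for n using f(1) by (auto simp: D_def)
    ultimately have "(\<lambda>n. semivariation M E m (D n)) \<longlonglongrightarrow> 0" by (intro semivariation_decseq)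
    moreover have "1 \<le> semivariation M E m (D n)" for n
      using f(3)[of n] by (rule order_trans) (auto intro!: semivariation_mono simp: D_def)
    ultimately have "1 \<le> (0::ennreal)" by (intro LIMSEQ_le_const) auto
    then show False by simp
  qed
  moreover have "semivariation M E m A \<le> semivariation M E m (space M)"
  proof (rule semivariation_least, rule semivariation_upper, goal_cases)
    case (4 n B v i)
    then show ?case using sets.sets_into_space by blast
  qed auto
  ultimately show ?thesis by (rule le_less_trans[rotated])
qed

text \<open>The semivariation as a real number, which loses nothing since it is finite.\<close>

definition sv :: "'a set \<Rightarrow> real" where "sv A = enn2real (semivariation M E m A)"

lemma semivariation_eq_sv: "semivariation M E m A = ennreal (sv A)"
  using semivariation_finite[of A] by (simp add: sv_def less_top)

lemma sv_nonneg: "0 \<le> sv A" by (simp add: sv_def)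

lemma sv_mono: "A \<subseteq> B \<Longrightarrow> sv A \<le> sv B"
  using semivariation_mono[of A B M E m] by (simp add: semivariation_eq_sv sv_nonneg)

lemma sv_upper:
  assumes "finite I" "disjoint_family_on B I"
    and "\<And>i. i \<in> I \<Longrightarrow> B i \<in> sets M" "\<And>i. i \<in> I \<Longrightarrow> B i \<subseteq> A"
    and "\<And>i. i \<in> I \<Longrightarrow> v i \<in> E" "\<And>i. i \<in> I \<Longrightarrow> norm (v i) \<le> c" "c \<ge> 0"
  shows "norm (\<Sum>i\<in>I. m (B i) (v i)) \<le> c * sv A"
  using semivariation_scaled[OF assms] \<open>c \<ge> 0\<close>
  by (simp add: semivariation_eq_sv sv_nonneg flip: ennreal_mult)

lemma sv_decseq:
  assumes "\<And>n. A n \<in> sets M" "decseq A" "(\<Inter>n. A n) = {}"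
  shows "(\<lambda>n. sv (A n)) \<longlonglongrightarrow> 0"
  using semivariation_decseq[OF assms]
  by (simp add: semivariation_eq_sv sv_nonneg ennreal_tendsto_0_iff)

text \<open>
  Convergence almost uniformly: a pointwise null sequence is eventually small outside a set
  of small semivariation.
\<close>

lemma sv_exceptional_sets:
  fixes g :: "nat \<Rightarrow> 'a \<Rightarrow> real"
  assumes meas: "\<And>n. g n \<in> borel_measurable M" and lim: "\<And>x. x \<in> space M \<Longrightarrow> (\<lambda>n. g n x) \<longlonglongrightarrow> 0"
    and "\<epsilon> > 0"
  defines "D \<equiv> \<lambda>n. {x \<in> space M. \<exists>j\<ge>n. \<epsilon> < g j x}"
  shows "D n \<in> sets M" and "(\<lambda>n. sv (D n)) \<longlonglongrightarrow> 0"
proof -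
  show D: "D n \<in> sets M" for n unfolding D_def using meas by measurable
  have "decseq D" by (auto simp: decseq_def D_def intro: order_trans)
  moreover have "(\<Inter>n. D n) = {}"
  proof -
    have False if x: "\<And>n. x \<in> D n" for x
    proof -
      have "x \<in> space M" using x[of 0] by (simp add: D_def)
      from order_tendstoD(2)[OF lim[OF this] \<open>\<epsilon> > 0\<close>]
      obtain N where "\<And>j. j \<ge> N \<Longrightarrow> g j x < \<epsilon>" by (auto simp: eventually_sequentially)
      then show False using x[of N] by (force simp: D_def)
    qed
    then show ?thesis by blast
  qed
  ultimately show "(\<lambda>n. sv (D n)) \<longlonglongrightarrow> 0" using D by (intro sv_decseq)
qed

end

section \<open>Integrals of simple functions\<close>

context additive_operator_measure
begin

text \<open>
  An integral can be computed on the level sets of any simple function through which the integrand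
  factors.  Applied to pairs, this gives additivity without a common refinement of partitions.
\<close>

lemma simple_integral_comp:
  assumes u: "simple_function M u" and A: "A \<in> sets M"
  shows "simple_integral_op M m A (\<lambda>x. g (u x))
    = (\<Sum>y\<in>u ` space M. m (A \<inter> (u -` {y} \<inter> space M)) (g y))"
proof -
  let ?S = "u ` space M" and ?P = "\<lambda>y. A \<inter> (u -` {y} \<inter> space M)"
  have fin: "finite ?S" using u by (rule simple_functionD)
  have P: "?P y \<in> sets M" for y using simple_functionD(2)[OF u, of "{y}"] A by blast
  have "(\<Sum>y\<in>?S. m (?P y) (g y)) = (\<Sum>v\<in>g ` ?S. \<Sum>y\<in>{y \<in> ?S. g y = v}. m (?P y) (g y))"
    using fin by (rule sum.image_gen)
  also have "\<dots> = (\<Sum>v\<in>g ` ?S. m (A \<inter> ((\<lambda>x. g (u x)) -` {v} \<inter> space M)) v)"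
  proof (rule sum.cong)
    fix v assume "v \<in> g ` ?S"
    have "(\<Sum>y\<in>{y \<in> ?S. g y = v}. m (?P y) (g y)) = (\<Sum>y\<in>{y \<in> ?S. g y = v}. m (?P y) v)"
      by simp
    also have "\<dots> = m (\<Union>y\<in>{y \<in> ?S. g y = v}. ?P y) v"
      using fin P by (intro additive_UN[symmetric]) (auto simp: disjoint_family_on_def)
    also have "(\<Union>y\<in>{y \<in> ?S. g y = v}. ?P y) = A \<inter> ((\<lambda>x. g (u x)) -` {v} \<inter> space M)"
      by auto
    finally show "(\<Sum>y\<in>{y \<in> ?S. g y = v}. m (?P y) (g y))
        = m (A \<inter> ((\<lambda>x. g (u x)) -` {v} \<inter> space M)) v" .
  qed simp
  finally show ?thesis by (simp add: simple_integral_op_def image_image)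
qed

lemma simple_integral_add:
  assumes s: "simple_function M s" and t: "simple_function M t" and A: "A \<in> sets M"
  shows "simple_integral_op M m A (\<lambda>x. s x + t x) = simple_integral_op M m A s + simple_integral_op M m A t"
proof -
  note comp = simple_integral_comp[OF simple_function_Pair[OF s t] A]
  have P: "A \<inter> ((\<lambda>x. (s x, t x)) -` {y} \<inter> space M) \<in> sets M" for y
    using simple_functionD(2)[OF simple_function_Pair[OF s t], of "{y}"] A by blast
  show ?thesis
    using comp[of "\<lambda>p. fst p + snd p"] comp[of fst] comp[of snd]
    by (simp add: linear_simps(1)[OF bounded_linear[OF P]] flip: sum.distrib)
qed

lemma simple_integral_scaleR:
  assumes s: "simple_function M s" and A: "A \<in> sets M"
  shows "simple_integral_op M m A (\<lambda>x. r *\<^sub>R s x) = r *\<^sub>R simple_integral_op M m A s"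
proof -
  note comp = simple_integral_comp[OF s A]
  have P: "A \<inter> (s -` {y} \<inter> space M) \<in> sets M" for y
    using simple_functionD(2)[OF s, of "{y}"] A by blast
  show ?thesis
    using comp[of "\<lambda>p. r *\<^sub>R p"] comp[of "\<lambda>p. p"]
    by (simp add: linear_simps(5)[OF bounded_linear[OF P]] flip: scaleR_sum_right)
qed

lemma simple_integral_diff:
  assumes s: "simple_function M s" and t: "simple_function M t" and A: "A \<in> sets M"
  shows "simple_integral_op M m A (\<lambda>x. s x - t x) = simple_integral_op M m A s - simple_integral_op M m A t"
proof -
  have t': "simple_function M (\<lambda>x. (-1) *\<^sub>R t x)" by (rule simple_function_compose1[OF t])
  show ?thesis
    using simple_integral_add[OF s t' A] simple_integral_scaleR[OF t A, of "-1"] by simp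
qed

lemma simple_integral_Un:
  assumes s: "simple_function M s" and "A \<in> sets M" "B \<in> sets M" "A \<inter> B = {}"
  shows "simple_integral_op M m (A \<union> B) s = simple_integral_op M m A s + simple_integral_op M m B s"
proof -
  have "m ((A \<union> B) \<inter> (s -` {v} \<inter> space M)) v
      = m (A \<inter> (s -` {v} \<inter> space M)) v + m (B \<inter> (s -` {v} \<inter> space M)) v" for v
    unfolding Int_Un_distrib2 using assms simple_functionD(2)[OF s, of "{v}"]
    by (intro additive) auto
  then show ?thesis by (simp add: simple_integral_op_def sum.distrib)
qed

lemma simple_integral_restrict:
  assumes s: "simple_function M s" and A: "A \<in> sets M"
  shows "simple_integral_op M m A s = (\<Sum>v\<in>s ` A. m (A \<inter> (s -` {v} \<inter> space M)) v)"
proof -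
  have outside: "m (A \<inter> (s -` {v} \<inter> space M)) v = 0" if "v \<notin> s ` A" for v
  proof -
    have "A \<inter> (s -` {v} \<inter> space M) = {}" using that by blast
    then show ?thesis by (simp only: empty)
  qed
  show ?thesis
    unfolding simple_integral_op_def
  proof (rule sum.mono_neutral_right)
    show "finite (s ` space M)" by (rule simple_functionD(1)[OF s])
    show "s ` A \<subseteq> s ` space M" using sets.sets_into_space[OF A] by (rule image_mono)
    show "\<forall>v\<in>s ` space M - s ` A. m (A \<inter> (s -` {v} \<inter> space M)) v = 0"
      using outside by blast
  qed
qed

end

context continuous_operator_measure
begin

lemma norm_simple_integral_le:
  assumes s: "simple_function M s" "s ` space M \<subseteq> E" and A: "A \<in> sets M"
    and c: "\<And>x. x \<in> A \<Longrightarrow> norm (s x) \<le> c" "c \<ge> 0"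
  shows "norm (simple_integral_op M m A s) \<le> c * sv A"
  unfolding simple_integral_restrict[OF s(1) A]
proof (rule sv_upper)
  show "finite (s ` A)"
    by (rule finite_subset[OF image_mono[OF sets.sets_into_space[OF A]] simple_functionD(1)[OF s(1)]])
  show "A \<inter> (s -` {v} \<inter> space M) \<in> sets M" for v
    using simple_functionD(2)[OF s(1), of "{v}"] A by blast
qed (use s c sets.sets_into_space[OF A] in \<open>auto simp: disjoint_family_on_def\<close>)

lemma norm_simple_integral_le_split:
  assumes s: "simple_function M s" "s ` space M \<subseteq> E" and A: "A \<in> sets M" and D: "D \<in> sets M"
    and c: "\<And>x. x \<in> A \<Longrightarrow> norm (s x) \<le> c" "c \<ge> 0"
    and \<epsilon>: "\<And>x. x \<in> A \<Longrightarrow> x \<notin> D \<Longrightarrow> norm (s x) \<le> \<epsilon>" "\<epsilon> \<ge> 0"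
  shows "norm (simple_integral_op M m A s) \<le> \<epsilon> * sv A + c * sv D"
proof -
  have "simple_integral_op M m ((A - D) \<union> (A \<inter> D)) s
      = simple_integral_op M m (A - D) s + simple_integral_op M m (A \<inter> D) s"
    using A D s by (intro simple_integral_Un) auto
  moreover have "norm (simple_integral_op M m (A - D) s) \<le> \<epsilon> * sv (A - D)"
    using assms by (intro norm_simple_integral_le) auto
  moreover have "norm (simple_integral_op M m (A \<inter> D) s) \<le> c * sv (A \<inter> D)"
    using assms by (intro norm_simple_integral_le) auto
  moreover have "\<epsilon> * sv (A - D) \<le> \<epsilon> * sv A" "c * sv (A \<inter> D) \<le> c * sv D"
    using c(2) \<epsilon>(2) by (auto intro!: mult_left_mono sv_mono)
  moreover have "(A - D) \<union> (A \<inter> D) = A" by blast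
  ultimately show ?thesis
    using norm_triangle_ineq[of "simple_integral_op M m (A - D) s" "simple_integral_op M m (A \<inter> D) s"]
    by simp
qed

lemma simple_function_bounded:
  assumes "simple_function M s"
  obtains c :: real where "c \<ge> 0" "\<And>x. x \<in> space M \<Longrightarrow> norm (s x) \<le> c"
proof -
  obtain c where "\<And>x. x \<in> space M \<Longrightarrow> norm (s x) \<le> c"
    using finite_imp_bounded[of "s ` space M"] simple_functionD(1)[OF assms] by (auto simp: bounded_iff)
  then show thesis using that[of "max c 0"] by (metis max.coboundedI1 max.cobounded2)
qed

section \<open>The Dobrakov integral\<close>

text \<open>
  The sequence need not be bounded.  It is bounded by \<open>1\<close> from index \<open>k\<close> on over a set \<open>F k\<close>, and
  these sets exhaust the space; inside them bounded convergence applies, and the gliding hump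
  passes to the whole space.
\<close>

lemma simple_integrals_of_null_sequence:
  assumes u: "\<And>n. simple_function M (u n)" "\<And>n. u n ` space M \<subseteq> E"
    and lim: "\<And>x. x \<in> space M \<Longrightarrow> (\<lambda>n. u n x) \<longlonglongrightarrow> 0"
    and conv: "\<And>A. A \<in> sets M \<Longrightarrow> convergent (\<lambda>n. simple_integral_op M m A (u n))"
    and A: "A \<in> sets M"
  shows "(\<lambda>n. simple_integral_op M m A (u n)) \<longlonglongrightarrow> 0"
proof -
  have meas: "(\<lambda>x. norm (u n x)) \<in> borel_measurable M" for n
    by (intro borel_measurable_simple_function simple_function_compose1[where g=norm] u)
  have lim': "(\<lambda>n. norm (u n x)) \<longlonglongrightarrow> 0" if "x \<in> space M" for x
    using lim[OF that] by (rule tendsto_norm_zero)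
  define D where "D \<epsilon> n = {x \<in> space M. \<exists>j\<ge>n. \<epsilon> < norm (u j x)}" for \<epsilon> n
  have D: "D \<epsilon> n \<in> sets M" "(\<lambda>n. sv (D \<epsilon> n)) \<longlonglongrightarrow> 0" if "\<epsilon> > 0" for \<epsilon> n
    unfolding D_def using sv_exceptional_sets[OF meas lim' that] by blast+
  define F where "F k = space M - D 1 k" for k
  show ?thesis
  proof (rule gliding_hump[where E = F])
    show "simple_integral_op M m (A \<union> B) (u n) = simple_integral_op M m A (u n) + simple_integral_op M m B (u n)"
      if "A \<in> sets M" "B \<in> sets M" "A \<inter> B = {}" for n A B
      using that u by (intro simple_integral_Un)
    show "F k \<in> sets M" for k using D by (auto simp: F_def)
    show "incseq F" by (auto simp: incseq_def F_def D_def intro: order_trans)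
    show "\<exists>N. \<forall>n\<ge>N. \<forall>A\<in>sets M. A \<subseteq> F k \<longrightarrow> norm (simple_integral_op M m A (u n)) < \<delta>"
      if \<delta>: "\<delta> > 0" for k \<delta>
    proof -
      define \<epsilon> where "\<epsilon> = \<delta> / (2 * (sv (space M) + 1))"
      have \<epsilon>: "\<epsilon> > 0" using \<delta> sv_nonneg[of "space M"] by (simp add: \<epsilon>_def)
      have "\<epsilon> * sv (space M) < \<epsilon> * (sv (space M) + 1)" using \<epsilon> by simp
      also have "\<dots> = \<delta> / 2" using sv_nonneg[of "space M"] by (simp add: \<epsilon>_def divide_simps)
      finally have \<epsilon>': "\<epsilon> * sv (space M) < \<delta> / 2" .
      obtain N where N: "\<And>n. n \<ge> N \<Longrightarrow> sv (D \<epsilon> n) < \<delta> / 2"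
        using order_tendstoD(2)[OF D(2)[OF \<epsilon>], of "\<delta> / 2"] \<delta> by (auto simp: eventually_sequentially)
      have "norm (simple_integral_op M m A (u n)) < \<delta>"
        if n: "n \<ge> max N k" and A: "A \<in> sets M" "A \<subseteq> F k" for n A
      proof -
        have "norm (simple_integral_op M m A (u n)) \<le> \<epsilon> * sv A + 1 * sv (D \<epsilon> n)"
        proof (rule norm_simple_integral_le_split)
          show "norm (u n x) \<le> 1" if "x \<in> A" for x
            using that A n by (fastforce simp: F_def D_def not_less)
          show "norm (u n x) \<le> \<epsilon>" if "x \<in> A" "x \<notin> D \<epsilon> n" for x
            using that sets.sets_into_space[OF A(1)] by (fastforce simp: D_def not_less)
        qed (use u A D \<epsilon> in auto)
        also have "\<epsilon> * sv A \<le> \<epsilon> * sv (space M)"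
          using \<epsilon> sets.sets_into_space[OF A(1)] by (intro mult_left_mono sv_mono) auto
        finally show ?thesis using \<epsilon>' N[of n] n by simp
      qed
      then show ?thesis by blast
    qed
    show "\<exists>k. \<forall>A\<in>sets M. A \<inter> F k = {} \<longrightarrow> norm (simple_integral_op M m A (u n)) < \<delta>"
      if \<delta>: "\<delta> > 0" for n \<delta>
    proof -
      obtain c where c: "c \<ge> 0" "\<And>x. x \<in> space M \<Longrightarrow> norm (u n x) \<le> c"
        using simple_function_bounded[OF u(1)] by metis
      have "(\<lambda>k. c * sv (D 1 k)) \<longlonglongrightarrow> c * 0" by (intro tendsto_intros D) simp
      then obtain k where k: "c * sv (D 1 k) < \<delta>"
        using order_tendstoD(2)[of _ "c * 0" sequentially \<delta>] \<delta> by (auto simp: eventually_sequentially)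
      have "norm (simple_integral_op M m A (u n)) < \<delta>" if A: "A \<in> sets M" "A \<inter> F k = {}" for A
      proof -
        have "norm (simple_integral_op M m A (u n)) \<le> c * sv A"
          using u A c sets.sets_into_space[OF A(1)] by (intro norm_simple_integral_le) auto
        also have "\<dots> \<le> c * sv (D 1 k)"
          using c A sets.sets_into_space[OF A(1)] by (intro mult_left_mono sv_mono) (auto simp: F_def)
        finally show ?thesis using k by simp
      qed
      then show ?thesis by blast
    qed
  qed (use conv A in auto)
qed

lemma simple_integral_cong_AE:
  assumes s: "simple_function M s" "s ` space M \<subseteq> E" and t: "simple_function M t" "t ` space M \<subseteq> E"
    and N: "N \<in> sets M" "sv N = 0" and eq: "\<And>x. x \<in> space M \<Longrightarrow> x \<notin> N \<Longrightarrow> s x = t x" and A: "A \<in> sets M"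
  shows "simple_integral_op M m A s = simple_integral_op M m A t"
proof -
  have st: "simple_function M (\<lambda>x. s x - t x)" using s(1) t(1) by (rule simple_function_diff)
  obtain c where c: "c \<ge> 0" "\<And>x. x \<in> space M \<Longrightarrow> norm (s x - t x) \<le> c"
    using simple_function_bounded[OF st] by metis
  have "norm (simple_integral_op M m A (\<lambda>x. s x - t x)) \<le> 0 * sv A + c * sv N"
    using st s t subspace_E A N c eq sets.sets_into_space[OF A]
    by (intro norm_simple_integral_le_split) (auto intro!: subspace_diff)
  then show ?thesis using N simple_integral_diff[OF s(1) t(1) A] by simp
qed

theorem dobrakov_integral_eqI:
  assumes s: "dobrakov_approx M E m f s" and f: "f ` space M \<subseteq> E" and A: "A \<in> sets M"
    and lim: "(\<lambda>n. simple_integral_op M m A (s n)) \<longlonglongrightarrow> J"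
  shows "dobrakov_integral M E m A f = J"
  unfolding dobrakov_integral_def
proof (rule the_equality)
  show "dobrakov_integrable M E m f \<and>
      (\<exists>s. dobrakov_approx M E m f s \<and> (\<lambda>n. simple_integral_op M m A (s n)) \<longlonglongrightarrow> J)"
    using s f lim by (auto simp: dobrakov_integrable_def)
next
  fix J' assume "dobrakov_integrable M E m f \<and>
      (\<exists>s. dobrakov_approx M E m f s \<and> (\<lambda>n. simple_integral_op M m A (s n)) \<longlonglongrightarrow> J')"
  then obtain t where t: "dobrakov_approx M E m f t"
    and lim': "(\<lambda>n. simple_integral_op M m A (t n)) \<longlonglongrightarrow> J'" by blast
  obtain N1 where N1: "N1 \<in> sets M" "semivariation M E m N1 = 0"
      "\<And>x. x \<in> space M \<Longrightarrow> x \<notin> N1 \<Longrightarrow> (\<lambda>n. s n x) \<longlonglongrightarrow> f x"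
    using s by (auto simp: dobrakov_approx_def)
  obtain N2 where N2: "N2 \<in> sets M" "semivariation M E m N2 = 0"
      "\<And>x. x \<in> space M \<Longrightarrow> x \<notin> N2 \<Longrightarrow> (\<lambda>n. t n x) \<longlonglongrightarrow> f x"
    using t by (auto simp: dobrakov_approx_def)
  define N where "N = N1 \<union> N2"
  have "semivariation M E m N \<le> 0" using semivariation_Un[OF N1(1) N2(1)] N1 N2 by (simp add: N_def)
  then have N: "N \<in> sets M" "sv N = 0" using N1 N2 by (auto simp: N_def sv_def)
  have st: "simple_function M (s n)" "s n ` space M \<subseteq> E" "simple_function M (t n)" "t n ` space M \<subseteq> E" for n
    using s t by (auto simp: dobrakov_approx_def)
  define d where "d n x = s n x - t n x" for n x
  define u where "u n x = (if x \<in> N then 0 else d n x)" for n x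
  have d: "simple_function M (d n)" "d n ` space M \<subseteq> E" for n
    unfolding d_def using st[of n] subspace_E by (auto intro!: subspace_diff)
  have u: "simple_function M (u n)" "u n ` space M \<subseteq> E" for n
    unfolding u_def using d[of n] N(1) subspace_E sets.Int_space_eq2[OF N(1)]
    by (auto intro!: simple_function_If_set simple_function_const subspace_0)
  have ud: "simple_integral_op M m B (u n) = simple_integral_op M m B (s n) - simple_integral_op M m B (t n)"
    if "B \<in> sets M" for B n
    using simple_integral_cong_AE[OF u[of n] d[of n] N _ that] simple_integral_diff[OF st(1,3) that, of n n]
    by (simp add: u_def d_def[abs_def])
  have "(\<lambda>n. simple_integral_op M m A (u n)) \<longlonglongrightarrow> 0"
  proof (rule simple_integrals_of_null_sequence[OF u _ _ A])
    show "(\<lambda>n. u n x) \<longlonglongrightarrow> 0" if x: "x \<in> space M" for x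
    proof (cases "x \<in> N")
      case False
      then show ?thesis
        using tendsto_diff[OF N1(3)[OF x] N2(3)[OF x]] by (simp add: u_def d_def N_def)
    qed (simp add: u_def)
    show "convergent (\<lambda>n. simple_integral_op M m B (u n))" if "B \<in> sets M" for B
      using s t that by (auto simp: ud dobrakov_approx_def intro: convergent_diff)
  qed
  moreover have "(\<lambda>n. simple_integral_op M m A (u n)) \<longlonglongrightarrow> J - J'"
    using tendsto_diff[OF lim lim'] by (simp add: ud[OF A])
  ultimately have "J - J' = 0" using LIMSEQ_unique by blast
  then show "J' = J" by simp
qed

lemma Cauchy_simple_integrals:
  assumes s: "\<And>n. simple_function M (s n)" "\<And>n. s n ` space M \<subseteq> E"
    and C: "\<And>n x. x \<in> space M \<Longrightarrow> norm (s n x) \<le> C"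
    and lim: "\<And>x. x \<in> space M \<Longrightarrow> (\<lambda>n. s n x) \<longlonglongrightarrow> f x"
    and A: "A \<in> sets M"
  shows "Cauchy (\<lambda>n. simple_integral_op M m A (s n))"
proof (rule metric_CauchyI)
  fix \<delta> :: real assume \<delta>: "\<delta> > 0"
  define g where "g n x = norm (s n x - f x)" for n x
  have meas: "g n \<in> borel_measurable M" for n
  proof (rule borel_measurable_LIMSEQ_real)
    show "(\<lambda>k. norm (s n x - s k x)) \<longlonglongrightarrow> g n x" if "x \<in> space M" for x
      unfolding g_def by (intro tendsto_intros lim that)
    show "(\<lambda>x. norm (s n x - s k x)) \<in> borel_measurable M" for k
      by (intro borel_measurable_simple_function simple_function_compose2[where h="\<lambda>a b. norm (a - b)"] s)
  qed
  have g0: "(\<lambda>n. g n x) \<longlonglongrightarrow> 0" if "x \<in> space M" for x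
    unfolding g_def using lim[OF that] by (intro tendsto_norm_zero) (simp add: LIM_zero)
  define \<epsilon> where "\<epsilon> = \<delta> / (4 * (sv A + 1))"
  have \<epsilon>: "\<epsilon> > 0" using \<delta> sv_nonneg[of A] by (simp add: \<epsilon>_def)
  have "2 * \<epsilon> * sv A < 2 * \<epsilon> * (sv A + 1)" using \<epsilon> by simp
  also have "\<dots> = \<delta> / 2" using sv_nonneg[of A] by (simp add: \<epsilon>_def divide_simps)
  finally have \<epsilon>': "2 * \<epsilon> * sv A < \<delta> / 2" .
  define D where "D n = {x \<in> space M. \<exists>j\<ge>n. \<epsilon> < g j x}" for n
  have D: "D n \<in> sets M" "(\<lambda>n. sv (D n)) \<longlonglongrightarrow> 0" for n
    unfolding D_def using sv_exceptional_sets[OF meas g0 \<epsilon>] by blast+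
  define c where "c = \<bar>2 * C\<bar>"
  have "(\<lambda>k. c * sv (D k)) \<longlonglongrightarrow> c * 0" by (intro tendsto_intros D)
  then obtain N where N: "c * sv (D N) < \<delta> / 2"
    using order_tendstoD(2)[of _ "c * 0" sequentially "\<delta> / 2"] \<delta> by (auto simp: eventually_sequentially)
  have "dist (simple_integral_op M m A (s i)) (simple_integral_op M m A (s j)) < \<delta>" if ij: "i \<ge> N" "j \<ge> N" for i j
  proof -
    have "norm (simple_integral_op M m A (\<lambda>x. s i x - s j x)) \<le> (2 * \<epsilon>) * sv A + c * sv (D N)"
    proof (rule norm_simple_integral_le_split)
      show "simple_function M (\<lambda>x. s i x - s j x)" using s(1) s(1) by (rule simple_function_diff)
      show "(\<lambda>x. s i x - s j x) ` space M \<subseteq> E" using s(2)[of i] s(2)[of j] subspace_E by (auto intro!: subspace_diff)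
      show "norm (s i x - s j x) \<le> c" if "x \<in> A" for x
        using C[of x i] C[of x j] norm_triangle_ineq4[of "s i x" "s j x"] that sets.sets_into_space[OF A]
        by (force simp: c_def)
      show "norm (s i x - s j x) \<le> 2 * \<epsilon>" if "x \<in> A" "x \<notin> D N" for x
      proof -
        have "g i x \<le> \<epsilon>" "g j x \<le> \<epsilon>"
          using that ij sets.sets_into_space[OF A] by (auto simp: D_def not_less)
        then show ?thesis
          using norm_triangle_ineq4[of "s i x - f x" "s j x - f x"] by (simp add: g_def)
      qed
    qed (use \<epsilon> A D in \<open>auto simp: c_def\<close>)
    then show ?thesis
      using N \<epsilon>' simple_integral_diff[OF s(1) s(1) A, of i j] by (simp add: dist_norm)
  qed
  then show "\<exists>N. \<forall>i\<ge>N. \<forall>j\<ge>N. dist (simple_integral_op M m A (s i)) (simple_integral_op M m A (s j)) < \<delta>"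
    by blast
qed

end

lemma bounded_simple_dobrakov_approx:
  fixes m :: "'x set \<Rightarrow> 'e::real_normed_vector \<Rightarrow> 'g::banach"
  assumes "continuous_operator_measure M E m"
    and s: "\<And>n. simple_function M (s n)" "\<And>n. s n ` space M \<subseteq> E"
    and C: "\<And>n x. x \<in> space M \<Longrightarrow> norm (s n x) \<le> C"
    and lim: "\<And>x. x \<in> space M \<Longrightarrow> (\<lambda>n. s n x) \<longlonglongrightarrow> f x"
  shows "dobrakov_approx M E m f s"
proof -
  interpret continuous_operator_measure M E m by fact
  show ?thesis
    using s lim Cauchy_simple_integrals[OF s C lim] semivariation_empty
    by (auto simp: dobrakov_approx_def Cauchy_convergent_iff intro!: bexI[of _ "{}"])
qed

theorem simple_integrals_tendsto_dobrakov_integral: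
  fixes m :: "'x set \<Rightarrow> 'e::real_normed_vector \<Rightarrow> 'g::banach"
  assumes m: "continuous_operator_measure M E m"
    and s: "\<And>n. simple_function M (s n)" "\<And>n. s n ` space M \<subseteq> E"
    and C: "\<And>n x. x \<in> space M \<Longrightarrow> norm (s n x) \<le> C"
    and lim: "\<And>x. x \<in> space M \<Longrightarrow> (\<lambda>n. s n x) \<longlonglongrightarrow> f x"
    and f: "f ` space M \<subseteq> E" and A: "A \<in> sets M"
  shows "(\<lambda>n. simple_integral_op M m A (s n)) \<longlonglongrightarrow> dobrakov_integral M E m A f"
proof -
  interpret continuous_operator_measure M E m by fact
  have approx: "dobrakov_approx M E m f s"
    by (rule bounded_simple_dobrakov_approx[OF m s C lim])
  then obtain J where J: "(\<lambda>n. simple_integral_op M m A (s n)) \<longlonglongrightarrow> J"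
    using A by (auto simp: dobrakov_approx_def convergent_def)
  with dobrakov_integral_eqI[OF approx f A J] show ?thesis by simp
qed

section \<open>Operator measures and bounded measurable functions\<close>

lemma CA_empty:
  assumes "\<mu> \<in> CA M Y"
  shows "\<mu> {} = 0"
proof -
  have "(\<lambda>n::nat. \<mu> {}) sums \<mu> (\<Union>n::nat. {})"
    using assms by (auto simp: CA_def disjoint_family_on_def dest!: spec[of _ "\<lambda>_::nat. {}"])
  then have "(\<lambda>n::nat. \<mu> {}) \<longlonglongrightarrow> 0" by (intro summable_LIMSEQ_zero sums_summable)
  then show ?thesis by (simp add: LIMSEQ_const_iff)
qed

lemma CA_additive:
  assumes \<mu>: "\<mu> \<in> CA M Y" and "A \<in> sets M" "B \<in> sets M" "A \<inter> B = {}"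
  shows "\<mu> (A \<union> B) = \<mu> A + \<mu> B"
proof -
  have "range (binaryset A B) \<subseteq> sets M" using assms by (simp add: range_binaryset_eq)
  moreover have "disjoint_family (binaryset A B)"
    using assms by (auto simp: disjoint_family_on_def binaryset_def)
  ultimately have "(\<lambda>n. \<mu> (binaryset A B n)) sums \<mu> (\<Union>n. binaryset A B n)"
    using \<mu> unfolding CA_def by blast
  then have "(\<lambda>n. \<mu> (binaryset A B n)) sums \<mu> (A \<union> B)" by (simp add: UN_binaryset_eq)
  moreover have "(\<lambda>n. \<mu> (binaryset A B n)) sums (\<Sum>n<2. \<mu> (binaryset A B n))"
    by (rule sums_finite) (auto simp: binaryset_def CA_empty[OF \<mu>])
  moreover have "(\<Sum>n<2::nat. \<mu> (binaryset A B n)) = \<mu> A + \<mu> B"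
    by (simp add: numeral_2_eq_2 binaryset_def)
  ultimately show ?thesis by (metis sums_unique2)
qed

text \<open>
  The approximants in the definition of \<open>BSM\<close> are not assumed bounded; truncation keeps them below
  any simple function that strictly dominates the norm of the limit.
\<close>

lemma BSM_approx:
  fixes f :: "'x \<Rightarrow> 'y::real_normed_vector"
  assumes f: "f \<in> BSM M E" and "0 \<in> E"
    and b: "simple_function M b" "\<And>x. x \<in> space M \<Longrightarrow> norm (f x) < b x"
  obtains s :: "nat \<Rightarrow> 'x \<Rightarrow> 'y" where "\<And>n. simple_function M (s n)" "\<And>n. s n ` space M \<subseteq> E"
    "\<And>n x. x \<in> space M \<Longrightarrow> norm (s n x) \<le> b x" "\<And>x. x \<in> space M \<Longrightarrow> (\<lambda>n. s n x) \<longlonglongrightarrow> f x"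
proof -
  obtain s :: "nat \<Rightarrow> 'x \<Rightarrow> 'y" where s: "\<And>n. simple_function M (s n)" "\<And>n. s n ` space M \<subseteq> E"
      "\<And>x. x \<in> space M \<Longrightarrow> (\<lambda>n. s n x) \<longlonglongrightarrow> f x"
    using f unfolding BSM_def by blast
  define t where "t n x = (if norm (s n x) \<le> b x then s n x else 0)" for n x
  have "simple_function M (t n)" for n
    unfolding t_def
    using simple_function_compose2[OF s(1)[of n] b(1), of "\<lambda>u c. if norm u \<le> c then u else 0"] .
  moreover have "t n ` space M \<subseteq> E" for n using s(2)[of n] \<open>0 \<in> E\<close> by (auto simp: t_def)
  moreover have "norm (t n x) \<le> b x" if "x \<in> space M" for n x
  proof -
    have "0 \<le> b x" using b(2)[OF that] norm_ge_zero[of "f x"] by linarith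
    then show ?thesis by (simp add: t_def)
  qed
  moreover have "(\<lambda>n. t n x) \<longlonglongrightarrow> f x" if x: "x \<in> space M" for x
  proof -
    have "\<forall>\<^sub>F n in sequentially. norm (s n x) < b x"
      using order_tendstoD(2)[OF tendsto_norm[OF s(3)[OF x]] b(2)[OF x]] .
    then have "\<forall>\<^sub>F n in sequentially. s n x = t n x" by eventually_elim (simp add: t_def)
    then show ?thesis using s(3)[OF x] by (rule Lim_transform_eventually[rotated])
  qed
  ultimately show thesis by (rule that)
qed

lemma BSM_bound:
  assumes "f \<in> BSM M E"
  obtains C :: real where "0 \<le> C" "\<And>x. x \<in> space M \<Longrightarrow> norm (f x) \<le> C"
proof -
  obtain C where C: "\<forall>y\<in>f ` space M. norm y \<le> C" using assms by (auto simp: BSM_def bounded_iff)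
  show thesis by (rule that[of "max C 0"]) (use C in \<open>auto simp: max.coboundedI1\<close>)
qed

lemma BSM_bounded_approx:
  fixes f :: "'x \<Rightarrow> 'y::real_normed_vector"
  assumes f: "f \<in> BSM M E" and "0 \<in> E"
  obtains s :: "nat \<Rightarrow> 'x \<Rightarrow> 'y" and C :: real
  where "\<And>n. simple_function M (s n)" "\<And>n. s n ` space M \<subseteq> E"
    "\<And>n x. x \<in> space M \<Longrightarrow> norm (s n x) \<le> C" "\<And>x. x \<in> space M \<Longrightarrow> (\<lambda>n. s n x) \<longlonglongrightarrow> f x"
proof -
  obtain C where C: "0 \<le> C" "\<And>x. x \<in> space M \<Longrightarrow> norm (f x) \<le> C" using BSM_bound[OF f] by blast
  have "norm (f x) < C + 1" if "x \<in> space M" for x using C(2)[OF that] by simp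
  from BSM_approx[OF f \<open>0 \<in> E\<close> simple_function_const this]
  obtain s :: "nat \<Rightarrow> 'x \<Rightarrow> 'y" where "\<And>n. simple_function M (s n)" "\<And>n. s n ` space M \<subseteq> E"
    "\<And>n x. x \<in> space M \<Longrightarrow> norm (s n x) \<le> C + 1" "\<And>x. x \<in> space M \<Longrightarrow> (\<lambda>n. s n x) \<longlonglongrightarrow> f x"
    by blast
  then show thesis by (rule that)
qed

lemma BSM_norm_measurable:
  assumes "f \<in> BSM M E"
  shows "(\<lambda>x. norm (f x)) \<in> borel_measurable M"
proof -
  obtain s where s: "\<And>n::nat. simple_function M (s n)" "\<And>x. x \<in> space M \<Longrightarrow> (\<lambda>n. s n x) \<longlonglongrightarrow> f x"
    using assms unfolding BSM_def by blast
  show ?thesis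
    by (rule borel_measurable_LIMSEQ_real[OF tendsto_norm[OF s(2)]])
      (auto intro!: borel_measurable_simple_function simple_function_compose1[where g=norm] s)
qed

lemma BSM_lincomb:
  fixes f g :: "'x \<Rightarrow> 'y::real_normed_vector"
  assumes f: "f \<in> BSM M E" and g: "g \<in> BSM M E" and E: "subspace E"
  shows "(\<lambda>x. a *\<^sub>R f x + b *\<^sub>R g x) \<in> BSM M E"
proof -
  obtain s where s: "\<And>n::nat. simple_function M (s n)" "\<And>n. s n ` space M \<subseteq> E"
      "\<And>x. x \<in> space M \<Longrightarrow> (\<lambda>n. s n x) \<longlonglongrightarrow> f x"
    using f unfolding BSM_def by blast
  obtain t where t: "\<And>n::nat. simple_function M (t n)" "\<And>n. t n ` space M \<subseteq> E"
      "\<And>x. x \<in> space M \<Longrightarrow> (\<lambda>n. t n x) \<longlonglongrightarrow> g x"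
    using g unfolding BSM_def by blast
  obtain C where C: "\<And>x. x \<in> space M \<Longrightarrow> norm (f x) \<le> C" using BSM_bound[OF f] by blast
  obtain D where D: "\<And>x. x \<in> space M \<Longrightarrow> norm (g x) \<le> D" using BSM_bound[OF g] by blast
  have "norm (a *\<^sub>R f x + b *\<^sub>R g x) \<le> \<bar>a\<bar> * C + \<bar>b\<bar> * D" if "x \<in> space M" for x
    using C[OF that] D[OF that]
    by (intro norm_triangle_le) (auto intro!: add_mono mult_left_mono)
  then have "bounded ((\<lambda>x. a *\<^sub>R f x + b *\<^sub>R g x) ` space M)" by (auto simp: bounded_iff)
  moreover have "simple_function M (\<lambda>x. a *\<^sub>R s n x + b *\<^sub>R t n x)" for n
    by (rule simple_function_compose2[OF s(1)[of n] t(1)[of n], of "\<lambda>u v. a *\<^sub>R u + b *\<^sub>R v"])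
  moreover have "(\<lambda>x. a *\<^sub>R s n x + b *\<^sub>R t n x) ` space M \<subseteq> E" for n
    using s(2)[of n] t(2)[of n] E by (auto intro!: subspace_add subspace_scale)
  moreover have "(\<lambda>x. a *\<^sub>R f x + b *\<^sub>R g x) ` space M \<subseteq> E"
    using f g E by (auto simp: BSM_def image_subset_iff intro!: subspace_add subspace_scale)
  moreover have "(\<lambda>n. a *\<^sub>R s n x + b *\<^sub>R t n x) \<longlonglongrightarrow> a *\<^sub>R f x + b *\<^sub>R g x" if "x \<in> space M" for x
    using s(3)[OF that] t(3)[OF that] by (intro tendsto_intros)
  ultimately show ?thesis
    unfolding BSM_def by (auto intro!: exI[of _ "\<lambda>n x. a *\<^sub>R s n x + b *\<^sub>R t n x"])
qed

lemma norm_le_op_semivariation: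
  fixes \<mu> :: "'x set \<Rightarrow> 'v::real_normed_vector \<Rightarrow>\<^sub>L 'w::real_normed_vector"
  assumes "A \<in> sets M" "A \<subseteq> B"
  shows "ennreal (norm (\<mu> A)) \<le> op_semivariation M \<mu> B"
proof (cases "op_semivariation M \<mu> B" rule: ennreal_cases)
  case (real r)
  have unit: "norm (\<mu> A v) \<le> r" if "norm v \<le> 1" for v
  proof -
    have "ennreal (norm (\<Sum>i\<in>{()}. \<mu> A v)) \<le> op_semivariation M \<mu> B"
      unfolding op_semivariation_def using assms that
      by (intro semivariation_upper[where m="\<lambda>A. blinfun_apply (\<mu> A)"]) (auto simp: disjoint_family_on_def)
    then show ?thesis using real by simp
  qed
  have "norm (\<mu> A v) \<le> r * norm v" for v
  proof (cases "v = 0")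
    case False
    have "norm (\<mu> A (v /\<^sub>R norm v)) \<le> r" using False by (intro unit) simp
    then show ?thesis using False by (simp add: blinfun.scaleR_right field_simps)
  qed simp
  then have "norm (\<mu> A) \<le> r" using real by (intro norm_blinfun_bound)
  then show ?thesis using real by (simp add: ennreal_leI)
qed simp

lemma op_semivariation_lincomb:
  fixes \<mu> \<nu> :: "'x set \<Rightarrow> 'v::real_normed_vector \<Rightarrow>\<^sub>L 'w::real_normed_vector"
  shows
  "op_semivariation M (\<lambda>A. a *\<^sub>R \<mu> A + b *\<^sub>R \<nu> A) A
    \<le> ennreal \<bar>a\<bar> * op_semivariation M \<mu> A + ennreal \<bar>b\<bar> * op_semivariation M \<nu> A"
  unfolding op_semivariation_def
proof (rule semivariation_least)
  fix n :: nat and B and v :: "nat \<Rightarrow> 'v"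
  assume B: "\<And>i. i < n \<Longrightarrow> B i \<in> sets M" "\<And>i. i < n \<Longrightarrow> B i \<subseteq> A" "disjoint_family_on B {..<n}"
    and v: "\<And>i. i < n \<Longrightarrow> norm (v i) \<le> 1"
  have "norm (\<Sum>i<n. blinfun_apply (a *\<^sub>R \<mu> (B i) + b *\<^sub>R \<nu> (B i)) (v i))
      \<le> \<bar>a\<bar> * norm (\<Sum>i<n. \<mu> (B i) (v i)) + \<bar>b\<bar> * norm (\<Sum>i<n. \<nu> (B i) (v i))"
  proof -
    have "(\<Sum>i<n. blinfun_apply (a *\<^sub>R \<mu> (B i) + b *\<^sub>R \<nu> (B i)) (v i))
        = a *\<^sub>R (\<Sum>i<n. \<mu> (B i) (v i)) + b *\<^sub>R (\<Sum>i<n. \<nu> (B i) (v i))"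
      by (simp add: blinfun.add_left blinfun.scaleR_left sum.distrib scaleR_sum_right)
    then show ?thesis
      using norm_triangle_ineq[of "a *\<^sub>R (\<Sum>i<n. \<mu> (B i) (v i))" "b *\<^sub>R (\<Sum>i<n. \<nu> (B i) (v i))"] by simp
  qed
  then have "ennreal (norm (\<Sum>i<n. blinfun_apply (a *\<^sub>R \<mu> (B i) + b *\<^sub>R \<nu> (B i)) (v i)))
      \<le> ennreal \<bar>a\<bar> * ennreal (norm (\<Sum>i<n. \<mu> (B i) (v i))) + ennreal \<bar>b\<bar> * ennreal (norm (\<Sum>i<n. \<nu> (B i) (v i)))"
    by (simp add: ennreal_leI flip: ennreal_mult ennreal_plus)
  also have "\<dots> \<le> ennreal \<bar>a\<bar> * semivariation M UNIV (\<lambda>A. blinfun_apply (\<mu> A)) A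
      + ennreal \<bar>b\<bar> * semivariation M UNIV (\<lambda>A. blinfun_apply (\<nu> A)) A"
    using B v
    by (intro add_mono mult_left_mono semivariation_upper[where m="\<lambda>A. blinfun_apply (\<mu> A)"]
        semivariation_upper[where m="\<lambda>A. blinfun_apply (\<nu> A)"]) auto
  finally show "ennreal (norm (\<Sum>i<n. blinfun_apply (a *\<^sub>R \<mu> (B i) + b *\<^sub>R \<nu> (B i)) (v i)))
    \<le> ennreal \<bar>a\<bar> * semivariation M UNIV (\<lambda>A. blinfun_apply (\<mu> A)) A
      + ennreal \<bar>b\<bar> * semivariation M UNIV (\<lambda>A. blinfun_apply (\<nu> A)) A" .
qed

lemma ennreal_pos_real_less:
  assumes "(0::ennreal) < e"
  obtains \<delta> :: real where "\<delta> > 0" "ennreal \<delta> < e"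
proof -
  obtain d where d: "0 < d" "d < e" using dense[OF assms] by blast
  then have "d < top" using less_top_ennreal order.strict_trans2 top_greatest by blast
  show thesis
  proof (rule that)
    show "enn2real d > 0" using d \<open>d < top\<close> by (simp add: enn2real_positive_iff)
    show "ennreal (enn2real d) < e" using d \<open>d < top\<close> by simp
  qed
qed

lemma tendsto_cmult_ennreal_0:
  assumes "(f \<longlongrightarrow> (0::ennreal)) F"
  shows "((\<lambda>x. ennreal c * f x) \<longlongrightarrow> 0) F"
  using ennreal_tendsto_cmult[OF _ assms, of "ennreal c"] by simp

lemma CA_lincomb:
  assumes "\<mu> \<in> CA M Y" "\<nu> \<in> CA M Y" "subspace Y"
  shows "(\<lambda>A. a *\<^sub>R \<mu> A + b *\<^sub>R \<nu> A) \<in> CA M Y"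
  using assms unfolding CA_def
  by (auto intro!: subspace_add subspace_scale sums_add sums_scaleR_right)

text \<open>
  The countably additive \<open>Y\<close>-valued measures whose semivariation, as operators on all of \<open>'v\<close>, is
  continuous.
\<close>

definition CCA :: "'x measure \<Rightarrow> ('v::real_normed_vector \<Rightarrow>\<^sub>L 'w::real_normed_vector) set \<Rightarrow> ('x set \<Rightarrow> 'v \<Rightarrow>\<^sub>L 'w) set"
  where "CCA M Y = {\<mu> \<in> CA M Y. continuous_semivariation M UNIV (\<lambda>A. blinfun_apply (\<mu> A))}"

lemma continuous_semivariation_op:
  "continuous_semivariation M UNIV (\<lambda>A. blinfun_apply (\<mu> A)) \<longleftrightarrow>
    (\<forall>A::nat \<Rightarrow> 'x set. range A \<subseteq> sets M \<longrightarrow> decseq A \<longrightarrow> (\<Inter>n. A n) = {} \<longrightarrow>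
      (\<lambda>n. op_semivariation M \<mu> (A n)) \<longlonglongrightarrow> 0)"
  by (simp add: continuous_semivariation_def op_semivariation_def)

lemma CCA_lincomb:
  assumes \<mu>: "\<mu> \<in> CCA M Y" and \<nu>: "\<nu> \<in> CCA M Y" and Y: "subspace Y"
  shows "(\<lambda>A. a *\<^sub>R \<mu> A + b *\<^sub>R \<nu> A) \<in> CCA M Y"
proof -
  have "(\<lambda>n. op_semivariation M (\<lambda>A. a *\<^sub>R \<mu> A + b *\<^sub>R \<nu> A) (A n)) \<longlonglongrightarrow> 0"
    if A: "range A \<subseteq> sets M" "decseq A" "(\<Inter>n. A n) = {}" for A :: "nat \<Rightarrow> 'a set"
  proof (rule tendsto_sandwich[OF _ _ tendsto_const])
    have "(\<lambda>n. op_semivariation M \<mu> (A n)) \<longlonglongrightarrow> 0" "(\<lambda>n. op_semivariation M \<nu> (A n)) \<longlonglongrightarrow> 0"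
      using \<mu> \<nu> A by (auto simp: CCA_def continuous_semivariation_op)
    then show "(\<lambda>n. ennreal \<bar>a\<bar> * op_semivariation M \<mu> (A n) + ennreal \<bar>b\<bar> * op_semivariation M \<nu> (A n)) \<longlonglongrightarrow> 0"
      using tendsto_add[OF tendsto_cmult_ennreal_0 tendsto_cmult_ennreal_0, of _ sequentially _ "\<bar>a\<bar>" "\<bar>b\<bar>"] by fastforce
  qed (auto intro!: always_eventually op_semivariation_lincomb)
  then show ?thesis
    using CA_lincomb[OF _ _ Y, of \<mu> M \<nu>] \<mu> \<nu> unfolding CCA_def continuous_semivariation_op by blast
qed

lemma CCA_continuous_operator_measure:
  assumes "\<mu> \<in> CCA M Y"
  shows "continuous_operator_measure M UNIV (\<lambda>A. blinfun_apply (\<mu> A))"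
proof (intro continuous_operator_measure.intro additive_operator_measure.intro continuous_operator_measure_axioms.intro)
  have \<mu>: "\<mu> \<in> CA M Y" using assms by (simp add: CCA_def)
  show "\<mu> (A \<union> B) v = \<mu> A v + \<mu> B v" if "A \<in> sets M" "B \<in> sets M" "A \<inter> B = {}" for A B v
    using CA_additive[OF \<mu> that] by (simp add: blinfun.add_left)
  show "continuous_semivariation M UNIV (\<lambda>A. blinfun_apply (\<mu> A))" using assms by (simp add: CCA_def)
qed (auto simp: blinfun.bounded_linear_right)

text \<open>
  The semivariation of \<open>A \<mapsto> (F \<mapsto> \<mu> A \<circ> F)\<close>, against which products are integrated, is at most that
  of \<open>\<mu>\<close>, because \<open>(\<mu> A \<circ> F) v = \<mu> A (F v)\<close>.
\<close>

lemma semivariation_compose_le: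
  fixes \<mu> :: "'x set \<Rightarrow> 'v::real_normed_vector \<Rightarrow>\<^sub>L 'w::real_normed_vector"
    and LV :: "('u::real_normed_vector \<Rightarrow>\<^sub>L 'v) set"
  shows
  "semivariation M LV (\<lambda>B F. \<mu> B o\<^sub>L F) A \<le> op_semivariation M \<mu> A"
proof (cases "op_semivariation M \<mu> A" rule: ennreal_cases)
  case (real r)
  show ?thesis
  proof (rule semivariation_least)
    fix n :: nat and B and F :: "nat \<Rightarrow> 'u \<Rightarrow>\<^sub>L 'v"
    assume B: "\<And>i. i < n \<Longrightarrow> B i \<in> sets M" "\<And>i. i < n \<Longrightarrow> B i \<subseteq> A" "disjoint_family_on B {..<n}"
      and F: "\<And>i. i < n \<Longrightarrow> norm (F i) \<le> 1"
    have unit: "norm ((\<Sum>i<n. \<mu> (B i) o\<^sub>L F i) v) \<le> r" if v: "norm v \<le> 1" for v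
    proof -
      have "norm (F i v) \<le> 1" if "i < n" for i
        using norm_blinfun[of "F i" v] mult_mono[OF F[OF that] v] by simp
      then have "ennreal (norm (\<Sum>i<n. \<mu> (B i) (F i v))) \<le> op_semivariation M \<mu> A"
        unfolding op_semivariation_def using B
        by (intro semivariation_upper[where m="\<lambda>A. blinfun_apply (\<mu> A)"]) auto
      then show ?thesis using real by (simp add: blinfun.sum_left)
    qed
    have "norm ((\<Sum>i<n. \<mu> (B i) o\<^sub>L F i) v) \<le> r * norm v" for v
    proof (cases "v = 0")
      case False
      have "norm ((\<Sum>i<n. \<mu> (B i) o\<^sub>L F i) (v /\<^sub>R norm v)) \<le> r" using False by (intro unit) simp
      then show ?thesis using False by (simp add: blinfun.scaleR_right field_simps)
    qed simp
    then have "norm (\<Sum>i<n. \<mu> (B i) o\<^sub>L F i) \<le> r" using real by (intro norm_blinfun_bound)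
    then show "ennreal (norm (\<Sum>i<n. \<mu> (B i) o\<^sub>L F i)) \<le> op_semivariation M \<mu> A"
      using real by (simp add: ennreal_leI)
  qed
qed simp

lemma CCA_compose_continuous_operator_measure:
  assumes \<mu>: "\<mu> \<in> CCA M Y" and LV: "subspace LV"
  shows "continuous_operator_measure M LV (\<lambda>B F. \<mu> B o\<^sub>L F)"
proof (intro continuous_operator_measure.intro additive_operator_measure.intro continuous_operator_measure_axioms.intro)
  have CA: "\<mu> \<in> CA M Y" using assms by (simp add: CCA_def)
  show "\<mu> (A \<union> B) o\<^sub>L F = (\<mu> A o\<^sub>L F) + (\<mu> B o\<^sub>L F)" if "A \<in> sets M" "B \<in> sets M" "A \<inter> B = {}" for A B F
    using CA_additive[OF CA that] by (simp add: bounded_bilinear.add_left[OF bounded_bilinear_blinfun_compose])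
  show "continuous_semivariation M LV (\<lambda>B F. \<mu> B o\<^sub>L F)"
    unfolding continuous_semivariation_def
  proof (intro allI impI)
    fix A :: "nat \<Rightarrow> 'a set" assume A: "range A \<subseteq> sets M" "decseq A" "(\<Inter>n. A n) = {}"
    show "(\<lambda>n. semivariation M LV (\<lambda>B F. \<mu> B o\<^sub>L F) (A n)) \<longlonglongrightarrow> 0"
    proof (rule tendsto_sandwich[OF _ _ tendsto_const])
      show "(\<lambda>n. op_semivariation M \<mu> (A n)) \<longlonglongrightarrow> 0"
        using \<mu> A by (auto simp: CCA_def continuous_semivariation_op)
    qed (auto intro!: always_eventually semivariation_compose_le)
  qed
qed (auto simp: LV bounded_bilinear.bounded_linear_right[OF bounded_bilinear_blinfun_compose])

section \<open>Products of measures and functions\<close>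

text \<open>
  Spaces \<open>Y\<close> and \<open>LV\<close> of operators for which the product of a \<open>Y\<close>-valued measure and an
  \<open>LV\<close>-valued function is again \<open>Y\<close>-valued.  The intended example is \<open>L(V, W)\<close> and \<open>L(V)\<close> over a
  scalar field.
\<close>

locale operator_module =
  fixes M :: "'x measure"
    and Y :: "('v::real_normed_vector \<Rightarrow>\<^sub>L 'w::banach) set" and LV :: "('v \<Rightarrow>\<^sub>L 'v) set"
  assumes subspace_Y: "subspace Y" and closed_Y: "closed Y" and subspace_LV: "subspace LV"
    and compose_mem: "T \<in> Y \<Longrightarrow> F \<in> LV \<Longrightarrow> T o\<^sub>L F \<in> Y"
begin

lemma measure_mult_tendsto:
  assumes \<mu>: "\<mu> \<in> CCA M Y"
    and s: "\<And>n. simple_function M (s n)" "\<And>n. s n ` space M \<subseteq> LV"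
    and C: "\<And>n x. x \<in> space M \<Longrightarrow> norm (s n x) \<le> C"
    and lim: "\<And>x. x \<in> space M \<Longrightarrow> (\<lambda>n. s n x) \<longlonglongrightarrow> \<phi> x"
    and \<phi>: "\<phi> ` space M \<subseteq> LV" and A: "A \<in> sets M"
  shows "(\<lambda>n. simple_integral_op M (\<lambda>B F. \<mu> B o\<^sub>L F) A (s n)) \<longlonglongrightarrow> measure_mult M LV \<mu> \<phi> A"
  using simple_integrals_tendsto_dobrakov_integral[OF
      CCA_compose_continuous_operator_measure[OF \<mu> subspace_LV] s C lim \<phi> A] A
  by (simp add: measure_mult_def)

lemma BSM_image: "\<phi> \<in> BSM M LV \<Longrightarrow> \<phi> ` space M \<subseteq> LV"
  by (simp add: BSM_def)

lemma measure_mult_outside: "A \<notin> sets M \<Longrightarrow> measure_mult M LV \<mu> \<phi> A = 0"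
  by (simp add: measure_mult_def)

lemma measure_mult_mem:
  assumes \<mu>: "\<mu> \<in> CCA M Y" and \<phi>: "\<phi> \<in> BSM M LV" and A: "A \<in> sets M"
  shows "measure_mult M LV \<mu> \<phi> A \<in> Y"
proof -
  obtain s C where s: "\<And>n. simple_function M (s n)" "\<And>n. s n ` space M \<subseteq> LV"
    "\<And>n x. x \<in> space M \<Longrightarrow> norm (s n x) \<le> C" "\<And>x. x \<in> space M \<Longrightarrow> (\<lambda>n. s n x) \<longlonglongrightarrow> \<phi> x"
    using BSM_bounded_approx[OF \<phi> subspace_0[OF subspace_LV]] by blast
  have "simple_integral_op M (\<lambda>B F. \<mu> B o\<^sub>L F) A (s n) \<in> Y" for n
    unfolding simple_integral_op_def
  proof (rule subspace_sum[OF subspace_Y])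
    fix F assume "F \<in> s n ` space M"
    then have "F \<in> LV" using s(2) by blast
    moreover have "\<mu> (A \<inter> (s n -` {F} \<inter> space M)) \<in> Y"
      using simple_functionD(2)[OF s(1)[of n], of "{F}"] \<mu> A by (auto simp: CCA_def CA_def)
    ultimately show "\<mu> (A \<inter> (s n -` {F} \<inter> space M)) o\<^sub>L F \<in> Y" by (rule compose_mem[rotated])
  qed
  then show ?thesis
    using closed_sequentially[OF closed_Y _ measure_mult_tendsto[OF \<mu> s BSM_image[OF \<phi>] A]] by blast
qed

lemma measure_mult_additive:
  assumes \<mu>: "\<mu> \<in> CCA M Y" and \<phi>: "\<phi> \<in> BSM M LV" and AB: "A \<in> sets M" "B \<in> sets M" "A \<inter> B = {}"
  shows "measure_mult M LV \<mu> \<phi> (A \<union> B) = measure_mult M LV \<mu> \<phi> A + measure_mult M LV \<mu> \<phi> B"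
proof -
  interpret N: continuous_operator_measure M LV "\<lambda>B F. \<mu> B o\<^sub>L F"
    by (rule CCA_compose_continuous_operator_measure[OF \<mu> subspace_LV])
  obtain s C where s: "\<And>n. simple_function M (s n)" "\<And>n. s n ` space M \<subseteq> LV"
    "\<And>n x. x \<in> space M \<Longrightarrow> norm (s n x) \<le> C" "\<And>x. x \<in> space M \<Longrightarrow> (\<lambda>n. s n x) \<longlonglongrightarrow> \<phi> x"
    using BSM_bounded_approx[OF \<phi> subspace_0[OF subspace_LV]] by blast
  have lim: "(\<lambda>n. simple_integral_op M (\<lambda>B F. \<mu> B o\<^sub>L F) A (s n)) \<longlonglongrightarrow> measure_mult M LV \<mu> \<phi> A"
    if "A \<in> sets M" for A
    using measure_mult_tendsto[OF \<mu> s BSM_image[OF \<phi>] that] .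
  have "(\<lambda>n. simple_integral_op M (\<lambda>B F. \<mu> B o\<^sub>L F) (A \<union> B) (s n))
      \<longlonglongrightarrow> measure_mult M LV \<mu> \<phi> A + measure_mult M LV \<mu> \<phi> B"
    using tendsto_add[OF lim[OF AB(1)] lim[OF AB(2)]]
    by (simp add: N.simple_integral_Un[OF s(1) AB])
  moreover have "A \<union> B \<in> sets M" using AB by blast
  ultimately show ?thesis using lim LIMSEQ_unique by blast
qed

lemma measure_mult_lincomb_right:
  assumes \<mu>: "\<mu> \<in> CCA M Y" and \<phi>: "\<phi> \<in> BSM M LV" and \<psi>: "\<psi> \<in> BSM M LV"
  shows "measure_mult M LV \<mu> (\<lambda>x. a *\<^sub>R \<phi> x + b *\<^sub>R \<psi> x) A
    = a *\<^sub>R measure_mult M LV \<mu> \<phi> A + b *\<^sub>R measure_mult M LV \<mu> \<psi> A"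
proof (cases "A \<in> sets M")
  case A: True
  interpret N: continuous_operator_measure M LV "\<lambda>B F. \<mu> B o\<^sub>L F"
    by (rule CCA_compose_continuous_operator_measure[OF \<mu> subspace_LV])
  obtain s C where s: "\<And>n. simple_function M (s n)" "\<And>n. s n ` space M \<subseteq> LV"
    "\<And>n x. x \<in> space M \<Longrightarrow> norm (s n x) \<le> C" "\<And>x. x \<in> space M \<Longrightarrow> (\<lambda>n. s n x) \<longlonglongrightarrow> \<phi> x"
    using BSM_bounded_approx[OF \<phi> subspace_0[OF subspace_LV]] by blast
  obtain t D where t: "\<And>n. simple_function M (t n)" "\<And>n. t n ` space M \<subseteq> LV"
    "\<And>n x. x \<in> space M \<Longrightarrow> norm (t n x) \<le> D" "\<And>x. x \<in> space M \<Longrightarrow> (\<lambda>n. t n x) \<longlonglongrightarrow> \<psi> x"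
    using BSM_bounded_approx[OF \<psi> subspace_0[OF subspace_LV]] by blast
  let ?u = "\<lambda>n x. a *\<^sub>R s n x + b *\<^sub>R t n x"
  have as: "simple_function M (\<lambda>x. a *\<^sub>R s n x)" and bt: "simple_function M (\<lambda>x. b *\<^sub>R t n x)" for n
    by (rule simple_function_compose1[OF s(1)] simple_function_compose1[OF t(1)])+
  have "(\<lambda>n. simple_integral_op M (\<lambda>B F. \<mu> B o\<^sub>L F) A (?u n))
      \<longlonglongrightarrow> measure_mult M LV \<mu> (\<lambda>x. a *\<^sub>R \<phi> x + b *\<^sub>R \<psi> x) A"
  proof (rule measure_mult_tendsto[OF \<mu> _ _ _ _ _ A])
    show "simple_function M (?u n)" for n using as bt by (rule simple_function_add)
    show "?u n ` space M \<subseteq> LV" for n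
      using s(2)[of n] t(2)[of n] subspace_LV by (auto intro!: subspace_add subspace_scale)
    show "norm (?u n x) \<le> \<bar>a\<bar> * C + \<bar>b\<bar> * D" if "x \<in> space M" for n x
      using s(3)[OF that, of n] t(3)[OF that, of n]
      by (intro norm_triangle_le) (auto intro!: add_mono mult_left_mono)
    show "(\<lambda>n. ?u n x) \<longlonglongrightarrow> a *\<^sub>R \<phi> x + b *\<^sub>R \<psi> x" if "x \<in> space M" for x
      using s(4)[OF that] t(4)[OF that] by (intro tendsto_intros)
    show "(\<lambda>x. a *\<^sub>R \<phi> x + b *\<^sub>R \<psi> x) ` space M \<subseteq> LV"
      using BSM_lincomb[OF \<phi> \<psi> subspace_LV] by (rule BSM_image)
  qed
  moreover have "(\<lambda>n. simple_integral_op M (\<lambda>B F. \<mu> B o\<^sub>L F) A (?u n))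
      \<longlonglongrightarrow> a *\<^sub>R measure_mult M LV \<mu> \<phi> A + b *\<^sub>R measure_mult M LV \<mu> \<psi> A"
    unfolding N.simple_integral_add[OF as bt A] N.simple_integral_scaleR[OF s(1) A] N.simple_integral_scaleR[OF t(1) A]
    by (intro tendsto_intros measure_mult_tendsto[OF \<mu> s BSM_image[OF \<phi>] A]
        measure_mult_tendsto[OF \<mu> t BSM_image[OF \<psi>] A])
  ultimately show ?thesis by (rule LIMSEQ_unique)
qed (simp add: measure_mult_outside)

lemma measure_mult_lincomb_left:
  assumes \<mu>: "\<mu> \<in> CCA M Y" and \<nu>: "\<nu> \<in> CCA M Y" and \<phi>: "\<phi> \<in> BSM M LV"
  shows "measure_mult M LV (\<lambda>A. a *\<^sub>R \<mu> A + b *\<^sub>R \<nu> A) \<phi> A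
    = a *\<^sub>R measure_mult M LV \<mu> \<phi> A + b *\<^sub>R measure_mult M LV \<nu> \<phi> A"
proof (cases "A \<in> sets M")
  case A: True
  obtain s C where s: "\<And>n. simple_function M (s n)" "\<And>n. s n ` space M \<subseteq> LV"
    "\<And>n x. x \<in> space M \<Longrightarrow> norm (s n x) \<le> C" "\<And>x. x \<in> space M \<Longrightarrow> (\<lambda>n. s n x) \<longlonglongrightarrow> \<phi> x"
    using BSM_bounded_approx[OF \<phi> subspace_0[OF subspace_LV]] by blast
  have eq: "simple_integral_op M (\<lambda>B F. (a *\<^sub>R \<mu> B + b *\<^sub>R \<nu> B) o\<^sub>L F) A (s n)
     = a *\<^sub>R simple_integral_op M (\<lambda>B F. \<mu> B o\<^sub>L F) A (s n)
      + b *\<^sub>R simple_integral_op M (\<lambda>B F. \<nu> B o\<^sub>L F) A (s n)" for n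
    by (simp add: simple_integral_op_def bounded_bilinear.add_left[OF bounded_bilinear_blinfun_compose]
        bounded_bilinear.scaleR_left[OF bounded_bilinear_blinfun_compose] sum.distrib scaleR_sum_right)
  have "(\<lambda>n. simple_integral_op M (\<lambda>B F. (a *\<^sub>R \<mu> B + b *\<^sub>R \<nu> B) o\<^sub>L F) A (s n))
      \<longlonglongrightarrow> measure_mult M LV (\<lambda>A. a *\<^sub>R \<mu> A + b *\<^sub>R \<nu> A) \<phi> A"
    by (rule measure_mult_tendsto[OF CCA_lincomb[OF \<mu> \<nu> subspace_Y] s BSM_image[OF \<phi>] A])
  moreover have "(\<lambda>n. simple_integral_op M (\<lambda>B F. (a *\<^sub>R \<mu> B + b *\<^sub>R \<nu> B) o\<^sub>L F) A (s n))
      \<longlonglongrightarrow> a *\<^sub>R measure_mult M LV \<mu> \<phi> A + b *\<^sub>R measure_mult M LV \<nu> \<phi> A"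
    unfolding eq by (intro tendsto_intros measure_mult_tendsto[OF _ s BSM_image[OF \<phi>] A] \<mu> \<nu>)
  ultimately show ?thesis by (rule LIMSEQ_unique)
qed (simp add: measure_mult_outside)

text \<open>
  The sum of the integrals over disjoint \<open>B i\<close>, applied to vectors \<open>v i\<close>, is itself a sum of the
  kind that defines the semivariation of \<open>\<mu>\<close>.
\<close>

lemma norm_sum_simple_integral_le:
  fixes s :: "'x \<Rightarrow> 'v \<Rightarrow>\<^sub>L 'v"
  assumes \<mu>: "\<mu> \<in> CCA M Y" and s: "simple_function M s"
    and I: "finite I" "disjoint_family_on B I" "\<And>i. i \<in> I \<Longrightarrow> B i \<in> sets M" "\<And>i. i \<in> I \<Longrightarrow> B i \<subseteq> A"
    and v: "\<And>i. i \<in> I \<Longrightarrow> norm (v i) \<le> 1" and c: "\<And>x. x \<in> A \<Longrightarrow> norm (s x) \<le> c" "c \<ge> 0"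
  shows "ennreal (norm (\<Sum>i\<in>I. simple_integral_op M (\<lambda>B F. \<mu> B o\<^sub>L F) (B i) s (v i)))
    \<le> ennreal c * op_semivariation M \<mu> A"
proof -
  interpret N: continuous_operator_measure M LV "\<lambda>B F. \<mu> B o\<^sub>L F"
    by (rule CCA_compose_continuous_operator_measure[OF \<mu> subspace_LV])
  interpret m: continuous_operator_measure M UNIV "\<lambda>A. blinfun_apply (\<mu> A)"
    by (rule CCA_continuous_operator_measure[OF \<mu>])
  let ?P = "\<lambda>(i, F). B i \<inter> (s -` {F} \<inter> space M)"
  have fin: "finite (s ` B i)" if "i \<in> I" for i
    by (rule finite_subset[OF image_mono[OF sets.sets_into_space[OF I(3)[OF that]]] simple_functionD(1)[OF s]])
  have "(\<Sum>i\<in>I. simple_integral_op M (\<lambda>B F. \<mu> B o\<^sub>L F) (B i) s (v i))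
      = (\<Sum>i\<in>I. \<Sum>F\<in>s ` B i. \<mu> (?P (i, F)) (F (v i)))"
    using I by (intro sum.cong) (simp_all add: N.simple_integral_restrict[OF s] blinfun.sum_left)
  also have "\<dots> = (\<Sum>p\<in>Sigma I (\<lambda>i. s ` B i). \<mu> (?P p) (snd p (v (fst p))))"
    using I(1) fin by (simp add: sum.Sigma split_beta)
  finally have eq: "(\<Sum>i\<in>I. simple_integral_op M (\<lambda>B F. \<mu> B o\<^sub>L F) (B i) s (v i)) = \<dots>" .
  show ?thesis
    unfolding eq op_semivariation_def
  proof (rule m.semivariation_scaled)
    show "finite (Sigma I (\<lambda>i. s ` B i))" using I(1) fin by (rule finite_SigmaI)
    show "disjoint_family_on ?P (Sigma I (\<lambda>i. s ` B i))"
      using I(2) unfolding disjoint_family_on_def by fastforce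
    show "?P p \<in> sets M" if "p \<in> Sigma I (\<lambda>i. s ` B i)" for p
      using that I(3) simple_functionD(2)[OF s, of "{snd p}"] by (auto simp: split_beta)
    show "?P p \<subseteq> A" if "p \<in> Sigma I (\<lambda>i. s ` B i)" for p
      using that I(4)[of "fst p"] by (auto simp: split_beta)
    show "norm (snd p (v (fst p))) \<le> c" if p: "p \<in> Sigma I (\<lambda>i. s ` B i)" for p
    proof -
      have "norm (snd p) \<le> c" using p I(4) c by (auto simp: subset_iff)
      moreover have "norm (v (fst p)) \<le> 1" using p v by auto
      ultimately have "norm (snd p) * norm (v (fst p)) \<le> c * 1" using c(2) by (intro mult_mono) auto
      then show ?thesis using norm_blinfun[of "snd p" "v (fst p)"] by simp
    qed
  qed (use c in auto)
qed

text \<open>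
  The bound on \<open>\<phi>\<close> is needed on \<open>A\<close> only, so that the estimate can be used on the sets where a
  convergent sequence of functions is already small.
\<close>

lemma op_semivariation_measure_mult_le:
  assumes \<mu>: "\<mu> \<in> CCA M Y" and \<phi>: "\<phi> \<in> BSM M LV" and A: "A \<in> sets M"
    and c: "\<And>x. x \<in> A \<Longrightarrow> norm (\<phi> x) \<le> c" "c \<ge> 0"
  shows "op_semivariation M (measure_mult M LV \<mu> \<phi>) A \<le> ennreal c * op_semivariation M \<mu> A"
proof -
  interpret m: continuous_operator_measure M UNIV "\<lambda>A. blinfun_apply (\<mu> A)"
    by (rule CCA_continuous_operator_measure[OF \<mu>])
  have sv: "op_semivariation M \<mu> A = ennreal (m.sv A)"
    by (simp add: op_semivariation_def m.semivariation_eq_sv)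
  obtain C where C: "C \<ge> 0" "\<And>x. x \<in> space M \<Longrightarrow> norm (\<phi> x) \<le> C" using BSM_bound[OF \<phi>] by blast
  show ?thesis
    unfolding op_semivariation_def[of M "measure_mult M LV \<mu> \<phi>"]
  proof (rule semivariation_least)
    fix n :: nat and B and v :: "nat \<Rightarrow> 'v"
    assume B: "\<And>i. i < n \<Longrightarrow> B i \<in> sets M" "\<And>i. i < n \<Longrightarrow> B i \<subseteq> A" "disjoint_family_on B {..<n}"
      and v: "\<And>i. i < n \<Longrightarrow> norm (v i) \<le> 1"
    have le: "norm (\<Sum>i<n. measure_mult M LV \<mu> \<phi> (B i) (v i)) \<le> (c + \<delta>) * m.sv A" if \<delta>: "\<delta> > 0" for \<delta>
    proof -
      \<comment> \<open>A simple bound that is close to \<open>c\<close> on \<open>A\<close> and crude elsewhere.\<close>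
      define b where "b x = (if x \<in> A then c + \<delta> else C + 1)" for x
      have b: "simple_function M b"
        unfolding b_def using A by (intro simple_function_If_set simple_function_const) auto
      have "norm (\<phi> x) < b x" if "x \<in> space M" for x
        using C(2)[OF that] c(1)[of x] \<delta> by (auto simp: b_def)
      from BSM_approx[OF \<phi> subspace_0[OF subspace_LV] b this]
      obtain s where s: "\<And>n. simple_function M (s n)" "\<And>n. s n ` space M \<subseteq> LV"
        "\<And>n x. x \<in> space M \<Longrightarrow> norm (s n x) \<le> b x" "\<And>x. x \<in> space M \<Longrightarrow> (\<lambda>n. s n x) \<longlonglongrightarrow> \<phi> x"
        by blast
      have sC: "norm (s k x) \<le> max (c + \<delta>) (C + 1)" if "x \<in> space M" for k x
        using s(3)[OF that, of k] by (auto simp: b_def split: if_splits)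
      have "(\<lambda>k. norm (\<Sum>i<n. simple_integral_op M (\<lambda>B F. \<mu> B o\<^sub>L F) (B i) (s k) (v i)))
          \<longlonglongrightarrow> norm (\<Sum>i<n. measure_mult M LV \<mu> \<phi> (B i) (v i))"
        using B by (intro tendsto_intros measure_mult_tendsto[OF \<mu> s(1,2) sC s(4) BSM_image[OF \<phi>]]) auto
      moreover have "norm (\<Sum>i<n. simple_integral_op M (\<lambda>B F. \<mu> B o\<^sub>L F) (B i) (s k) (v i)) \<le> (c + \<delta>) * m.sv A" for k
      proof -
        have "ennreal (norm (\<Sum>i<n. simple_integral_op M (\<lambda>B F. \<mu> B o\<^sub>L F) (B i) (s k) (v i)))
          \<le> ennreal (c + \<delta>) * op_semivariation M \<mu> A"
        proof (rule norm_sum_simple_integral_le[OF \<mu> s(1)])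
          show "norm (s k x) \<le> c + \<delta>" if "x \<in> A" for x
            using s(3)[of x k] that sets.sets_into_space[OF A] by (auto simp: b_def)
        qed (use B v c \<delta> in auto)
        also have "\<dots> = ennreal ((c + \<delta>) * m.sv A)"
          unfolding sv using c \<delta> m.sv_nonneg[of A] by (intro ennreal_mult[symmetric]) auto
        finally show ?thesis using c \<delta> m.sv_nonneg[of A] by (simp del: ennreal_plus)
      qed
      ultimately show ?thesis by (intro LIMSEQ_le_const2) auto
    qed
    have "norm (\<Sum>i<n. measure_mult M LV \<mu> \<phi> (B i) (v i)) \<le> c * m.sv A"
    proof (rule field_le_epsilon)
      fix e :: real assume e: "e > 0"
      have pos: "m.sv A + 1 > 0" using m.sv_nonneg[of A] by linarith
      have "e / (m.sv A + 1) * m.sv A \<le> e" using e pos by (simp add: field_simps)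
      then show "norm (\<Sum>i<n. measure_mult M LV \<mu> \<phi> (B i) (v i)) \<le> c * m.sv A + e"
        using le[of "e / (m.sv A + 1)"] e pos by (simp add: distrib_right)
    qed
    then show "ennreal (norm (\<Sum>i<n. measure_mult M LV \<mu> \<phi> (B i) (v i))) \<le> ennreal c * op_semivariation M \<mu> A"
      using c(2) m.sv_nonneg[of A] by (simp add: sv ennreal_leI flip: ennreal_mult)
  qed
qed

lemma measure_mult_CCA:
  assumes \<mu>: "\<mu> \<in> CCA M Y" and \<phi>: "\<phi> \<in> BSM M LV"
  shows "measure_mult M LV \<mu> \<phi> \<in> CCA M Y"
proof -
  let ?\<nu> = "measure_mult M LV \<mu> \<phi>"
  obtain C where C: "C \<ge> 0" "\<And>x. x \<in> space M \<Longrightarrow> norm (\<phi> x) \<le> C" using BSM_bound[OF \<phi>] by blast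
  have bound: "op_semivariation M ?\<nu> A \<le> ennreal C * op_semivariation M \<mu> A" if "A \<in> sets M" for A
    using C sets.sets_into_space[OF that] by (intro op_semivariation_measure_mult_le[OF \<mu> \<phi> that]) auto
  have lim: "(\<lambda>n. op_semivariation M ?\<nu> (A n)) \<longlonglongrightarrow> 0"
    if A: "range A \<subseteq> sets M" "decseq A" "(\<Inter>n. A n) = {}" for A :: "nat \<Rightarrow> 'x set"
  proof (rule tendsto_sandwich[OF _ _ tendsto_const])
    have "(\<lambda>n. op_semivariation M \<mu> (A n)) \<longlonglongrightarrow> 0"
      using \<mu> A by (auto simp: CCA_def continuous_semivariation_op)
    then show "(\<lambda>n. ennreal C * op_semivariation M \<mu> (A n)) \<longlonglongrightarrow> 0" by (rule tendsto_cmult_ennreal_0)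
    show "\<forall>\<^sub>F n in sequentially. op_semivariation M ?\<nu> (A n) \<le> ennreal C * op_semivariation M \<mu> (A n)"
      using A(1) by (intro always_eventually allI bound) auto
  qed auto
  have "(\<lambda>n. ?\<nu> (F n)) sums ?\<nu> (\<Union>n. F n)"
    if F: "range F \<subseteq> sets M" "disjoint_family F" for F :: "nat \<Rightarrow> 'x set"
  proof -
    define T where "T n = (\<Union>k\<in>{n..}. F k)" for n
    have Fs: "F k \<in> sets M" for k using F(1) by auto
    have T: "T n \<in> sets M" for n unfolding T_def using Fs by auto
    \<comment> \<open>The remainder of the series is the value on a tail \<open>T n\<close>, and the tails decrease to the empty set.\<close>
    have partial: "(\<Sum>k<n. ?\<nu> (F k)) + ?\<nu> (T n) = ?\<nu> (\<Union>n. F n)" for n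
    proof (induction n)
      case 0 show ?case by (simp add: T_def atLeast_0)
    next
      case (Suc n)
      have "{n..} = insert n {Suc n..}" by auto
      then have "T n = F n \<union> T (Suc n)" by (simp add: T_def)
      moreover have "F n \<inter> T (Suc n) = {}"
        using F(2) by (auto simp: T_def disjoint_family_on_def) (metis IntI Suc_n_not_le_n empty_iff)
      ultimately have "?\<nu> (T n) = ?\<nu> (F n) + ?\<nu> (T (Suc n))"
        using measure_mult_additive[OF \<mu> \<phi> Fs[of n] T[of "Suc n"]] by simp
      with Suc show ?case by (simp add: algebra_simps)
    qed
    have T_lim: "(\<lambda>n. op_semivariation M ?\<nu> (T n)) \<longlonglongrightarrow> 0"
    proof (rule lim)
      show "range T \<subseteq> sets M" using T by auto
      show "decseq T" by (auto simp: decseq_def T_def intro: order_trans)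
      show "(\<Inter>n. T n) = {}"
      proof -
        have False if x: "\<And>n. x \<in> T n" for x
        proof -
          obtain k where k: "x \<in> F k" using x[of 0] by (auto simp: T_def)
          obtain j where "j \<ge> Suc k" "x \<in> F j" using x[of "Suc k"] by (auto simp: T_def)
          with k F(2) show False by (auto simp: disjoint_family_on_def) (metis IntI Suc_n_not_le_n empty_iff)
        qed
        then show ?thesis by blast
      qed
    qed
    have "(\<lambda>n. ennreal (norm (?\<nu> (T n)))) \<longlonglongrightarrow> 0"
    proof (rule tendsto_sandwich[OF _ _ tendsto_const T_lim])
      show "\<forall>\<^sub>F n in sequentially. ennreal (norm (?\<nu> (T n))) \<le> op_semivariation M ?\<nu> (T n)"
        using T by (intro always_eventually allI norm_le_op_semivariation) auto
    qed simp
    then have "(\<lambda>n. norm (?\<nu> (T n))) \<longlonglongrightarrow> 0"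
      by (simp add: ennreal_tendsto_0_iff)
    then have "(\<lambda>n. ?\<nu> (T n)) \<longlonglongrightarrow> 0" by (rule tendsto_norm_zero_cancel)
    then have "(\<lambda>n. ?\<nu> (\<Union>n. F n) - ?\<nu> (T n)) \<longlonglongrightarrow> ?\<nu> (\<Union>n. F n) - 0" by (intro tendsto_intros)
    moreover have "?\<nu> (\<Union>n. F n) - ?\<nu> (T n) = (\<Sum>k<n. ?\<nu> (F k))" for n
      using partial[of n] by (simp add: algebra_simps)
    ultimately show ?thesis by (simp add: sums_def)
  qed
  then show ?thesis
    using lim measure_mult_mem[OF \<mu> \<phi>]
    by (simp add: CCA_def CA_def continuous_semivariation_op measure_mult_outside)
qed

lemma measure_mult_dominated_convergence:
  assumes \<mu>: "\<mu> \<in> CCA M Y" and \<psi>: "\<And>n. \<psi> n \<in> BSM M LV"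
    and C: "\<And>n x. x \<in> space M \<Longrightarrow> norm (\<psi> n x) \<le> C" "C \<ge> 0"
    and lim: "\<And>x. x \<in> space M \<Longrightarrow> (\<lambda>n. \<psi> n x) \<longlonglongrightarrow> 0"
  shows "(\<lambda>n. sv_norm M (measure_mult M LV \<mu> (\<psi> n))) \<longlonglongrightarrow> 0"
proof -
  interpret m: continuous_operator_measure M UNIV "\<lambda>A. blinfun_apply (\<mu> A)"
    by (rule CCA_continuous_operator_measure[OF \<mu>])
  have sv: "op_semivariation M \<mu> A = ennreal (m.sv A)" for A
    by (simp add: op_semivariation_def m.semivariation_eq_sv)
  let ?X = "space M" and ?r = "\<lambda>n. enn2real (sv_norm M (measure_mult M LV \<mu> (\<psi> n)))"
  have norm_split: "sv_norm M (measure_mult M LV \<mu> (\<psi> n)) \<le> ennreal (\<epsilon> * m.sv ?X + C * m.sv D)"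
    if D: "D \<in> sets M" and \<epsilon>: "\<epsilon> \<ge> 0" "\<And>x. x \<in> ?X \<Longrightarrow> x \<notin> D \<Longrightarrow> norm (\<psi> n x) \<le> \<epsilon>" for n D \<epsilon>
  proof -
    interpret N: continuous_operator_measure M UNIV "\<lambda>A. blinfun_apply (measure_mult M LV \<mu> (\<psi> n) A)"
      by (rule CCA_continuous_operator_measure[OF measure_mult_CCA[OF \<mu> \<psi>]])
    have "sv_norm M (measure_mult M LV \<mu> (\<psi> n))
        \<le> op_semivariation M (measure_mult M LV \<mu> (\<psi> n)) (?X - D) + op_semivariation M (measure_mult M LV \<mu> (\<psi> n)) D"
      using N.semivariation_Un[of "?X - D" D] D sets.sets_into_space[OF D]
      by (simp add: sv_norm_def op_semivariation_def Un_absorb2)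
    also have "\<dots> \<le> ennreal \<epsilon> * op_semivariation M \<mu> (?X - D) + ennreal C * op_semivariation M \<mu> D"
      using D \<epsilon> C sets.sets_into_space[OF D]
      by (intro add_mono op_semivariation_measure_mult_le[OF \<mu> \<psi>]) auto
    also have "\<dots> \<le> ennreal \<epsilon> * op_semivariation M \<mu> ?X + ennreal C * op_semivariation M \<mu> D"
      unfolding sv using m.sv_mono[of "?X - D" ?X] by (intro add_mono mult_left_mono ennreal_leI) auto
    also have "\<dots> = ennreal (\<epsilon> * m.sv ?X + C * m.sv D)"
      using \<epsilon> C m.sv_nonneg by (simp add: sv ennreal_mult)
    finally show ?thesis .
  qed
  have "\<forall>\<^sub>F n in sequentially. sv_norm M (measure_mult M LV \<mu> (\<psi> n)) < e" if e: "e > 0" for e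
  proof -
    obtain \<delta> :: real where \<delta>: "\<delta> > 0" "ennreal \<delta> < e"
      using e by (rule ennreal_pos_real_less)
    have pos: "m.sv ?X + 1 > 0" using m.sv_nonneg[of ?X] by linarith
    define \<epsilon> where "\<epsilon> = \<delta> / (2 * (m.sv ?X + 1))"
    have \<epsilon>: "\<epsilon> > 0" using \<delta> pos by (simp add: \<epsilon>_def)
    have \<epsilon>': "\<epsilon> * m.sv ?X < \<delta> / 2" using \<delta> pos by (simp add: \<epsilon>_def field_simps)
    define D where "D n = {x \<in> ?X. \<exists>j\<ge>n. \<epsilon> < norm (\<psi> j x)}" for n
    have D: "D n \<in> sets M" "(\<lambda>n. m.sv (D n)) \<longlonglongrightarrow> 0" for n
      unfolding D_def
      using m.sv_exceptional_sets[OF BSM_norm_measurable[OF \<psi>] tendsto_norm_zero[OF lim] \<epsilon>] by blast+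
    have "(\<lambda>k. C * m.sv (D k)) \<longlonglongrightarrow> C * 0" by (intro tendsto_intros D)
    then have "\<forall>\<^sub>F n in sequentially. C * m.sv (D n) < \<delta> / 2"
      using \<delta> by (intro order_tendstoD(2)) auto
    then show ?thesis
    proof eventually_elim
      case (elim n)
      have "sv_norm M (measure_mult M LV \<mu> (\<psi> n)) \<le> ennreal (\<epsilon> * m.sv ?X + C * m.sv (D n))"
      proof (rule norm_split[OF D(1)])
        show "norm (\<psi> n x) \<le> \<epsilon>" if "x \<in> ?X" "x \<notin> D n" for x
        proof -
          have "\<not> \<epsilon> < norm (\<psi> n x)" using that unfolding D_def by blast
          then show ?thesis by simp
        qed
      qed (use \<epsilon> in simp)
      also have "\<dots> \<le> ennreal \<delta>" using elim \<epsilon>' by (intro ennreal_leI) simp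
      finally show ?case using \<delta> by simp
    qed
  qed
  then show ?thesis by (intro order_tendstoI) auto
qed

end

section \<open>Translations\<close>

lemma image_plus_sets_borel:
  fixes x :: "'x::real_normed_vector"
  shows "(\<lambda>y. y + x) ` A \<in> sets borel \<longleftrightarrow> A \<in> sets borel"
proof -
  have meas: "(\<lambda>y. y + z) ` B \<in> sets borel" if "B \<in> sets borel" for B and z :: 'x
  proof -
    have "(\<lambda>y. y + z) ` B = (\<lambda>y. y - z) -` B \<inter> space borel"
      by (auto simp: image_iff) (metis diff_add_cancel)
    also have "\<dots> \<in> sets borel"
      by (rule measurable_sets[OF borel_measurable_continuous_onI that]) (intro continuous_intros)
    finally show ?thesis .
  qed
  have inv: "(\<lambda>y. y + (- x)) ` (\<lambda>y. y + x) ` A = A" by (simp add: image_image)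
  show ?thesis using meas[of A x] meas[of "(\<lambda>y. y + x) ` A" "- x"] unfolding inv by blast
qed

lemma inj_plus: "inj (\<lambda>y. y + x :: 'x::ab_group_add)" by (auto simp: inj_on_def)

lemma surj_plus: "surj (\<lambda>y. y + x :: 'x::ab_group_add)"
  by (rule surjI[of _ "\<lambda>y. y - x"]) simp

lemma op_semivariation_shift:
  fixes x :: "'x::real_normed_vector"
    and \<mu> :: "'x set \<Rightarrow> 'b::real_normed_vector \<Rightarrow>\<^sub>L 'c::real_normed_vector"
  shows "op_semivariation borel (shift_measure x \<mu>) A = op_semivariation borel \<mu> ((\<lambda>y. y + x) ` A)"
proof -
  have le: "op_semivariation borel (shift_measure z \<nu>) B \<le> op_semivariation borel \<nu> ((\<lambda>y. y + z) ` B)" 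
    for z :: 'x and \<nu> :: "'x set \<Rightarrow> 'b \<Rightarrow>\<^sub>L 'c" and B
    unfolding op_semivariation_def
  proof (rule semivariation_least)
    fix n :: nat and C and v :: "nat \<Rightarrow> 'b"
    assume C: "\<And>i. i < n \<Longrightarrow> C i \<in> sets borel" "\<And>i. i < n \<Longrightarrow> C i \<subseteq> B" "disjoint_family_on C {..<n}"
      and v: "\<And>i. i < n \<Longrightarrow> norm (v i) \<le> 1"
    have "disjoint_family_on (\<lambda>i. (\<lambda>y. y + z) ` C i) {..<n}"
      using C(3) by (simp add: disjoint_family_on_def flip: image_Int[OF inj_plus])
    then show "ennreal (norm (\<Sum>i<n. shift_measure z \<nu> (C i) (v i)))
        \<le> semivariation borel UNIV (\<lambda>A. blinfun_apply (\<nu> A)) ((\<lambda>y. y + z) ` B)"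
      unfolding shift_measure_def using C v
      by (intro semivariation_upper[where m="\<lambda>A. blinfun_apply (\<nu> A)"]) (auto simp: image_plus_sets_borel)
  qed
  have "shift_measure (- x) (shift_measure x \<mu>) = \<mu>"
    by (simp add: shift_measure_def fun_eq_iff image_image)
  then show ?thesis
    using le[of x \<mu> A] le[of "- x" "shift_measure x \<mu>" "(\<lambda>y. y + x) ` A"]
    by (intro antisym) (auto simp: image_image)
qed

lemma sv_norm_shift:
  fixes x :: "'x::real_normed_vector"
  shows "sv_norm borel (shift_measure x \<mu>) = sv_norm borel \<mu>"
  using surj_plus[of x] by (simp add: sv_norm_def op_semivariation_shift)

lemma CA_shift:
  fixes x :: "'x::real_normed_vector"
  assumes "\<mu> \<in> CA borel Y"
  shows "shift_measure x \<mu> \<in> CA borel Y"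
proof -
  let ?\<tau> = "\<lambda>A. (\<lambda>y. y + x) ` A"
  have "(\<lambda>n. \<mu> (?\<tau> (F n))) sums \<mu> (?\<tau> (\<Union>n. F n))"
    if F: "range F \<subseteq> sets borel" "disjoint_family F" for F :: "nat \<Rightarrow> 'x set"
  proof -
    have "range (\<lambda>n. ?\<tau> (F n)) \<subseteq> sets borel" using F(1) by (auto simp: image_plus_sets_borel)
    moreover have "disjoint_family (\<lambda>n. ?\<tau> (F n))" using F(2) by (simp add: disjoint_family_on_def flip: image_Int[OF inj_plus])
    ultimately have "(\<lambda>n. \<mu> (?\<tau> (F n))) sums \<mu> (\<Union>n. ?\<tau> (F n))"
      using assms unfolding CA_def by blast
    then show ?thesis by (simp add: image_UN)
  qed
  then show ?thesis
    using assms by (simp add: CA_def shift_measure_def image_plus_sets_borel)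
qed

lemma CCA_shift:
  fixes x :: "'x::real_normed_vector"
  assumes "\<mu> \<in> CCA borel Y"
  shows "shift_measure x \<mu> \<in> CCA borel Y"
proof -
  let ?\<tau> = "\<lambda>A. (\<lambda>y. y + x) ` A"
  have "(\<lambda>n. op_semivariation borel (shift_measure x \<mu>) (A n)) \<longlonglongrightarrow> 0"
    if A: "range A \<subseteq> sets borel" "decseq A" "(\<Inter>n. A n) = {}" for A :: "nat \<Rightarrow> 'x set"
  proof -
    have "range (\<lambda>n. ?\<tau> (A n)) \<subseteq> sets borel" using A(1) by (auto simp: image_plus_sets_borel)
    moreover have "decseq (\<lambda>n. ?\<tau> (A n))" using A(2) by (fastforce simp: decseq_def)
    moreover have "(\<Inter>n. ?\<tau> (A n)) = {}"
      using image_INT[OF inj_plus[of x], of UNIV A 0] A(3) by simp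
    ultimately show ?thesis
      using assms by (simp add: CCA_def continuous_semivariation_op op_semivariation_shift)
  qed
  moreover have "shift_measure x \<mu> \<in> CA borel Y" using assms by (simp add: CCA_def CA_shift)
  ultimately show ?thesis unfolding CCA_def continuous_semivariation_op by blast
qed

lemma simple_function_shift:
  fixes x :: "'x::real_normed_vector"
  assumes s: "simple_function borel s"
  shows "simple_function borel (\<lambda>y. s (y + x))"
  unfolding simple_function_def
proof (intro conjI ballI)
  show "finite ((\<lambda>y. s (y + x)) ` space borel)"
    by (rule finite_subset[OF _ simple_functionD(1)[OF s]]) auto
  fix v assume "v \<in> (\<lambda>y. s (y + x)) ` space borel"
  have "s -` {v} \<in> sets borel" using simple_functionD(2)[OF s, of "{v}"] by simp
  moreover have "(\<lambda>y. y + x) ` ((\<lambda>y. s (y + x)) -` {v}) = s -` {v}"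
    using surj_image_vimage_eq[OF surj_plus[of x], of "s -` {v}"] by (simp add: vimage_def)
  ultimately have "(\<lambda>y. s (y + x)) -` {v} \<in> sets borel"
    using image_plus_sets_borel[of x "(\<lambda>y. s (y + x)) -` {v}"] by simp
  then show "(\<lambda>y. s (y + x)) -` {v} \<inter> space borel \<in> sets borel" by simp
qed

lemma BSM_shift:
  fixes x :: "'x::real_normed_vector"
  assumes f: "f \<in> BSM borel E"
  shows "(\<lambda>y. f (y + x)) \<in> BSM borel E"
proof -
  obtain s :: "nat \<Rightarrow> 'x \<Rightarrow> 'a" where s: "\<And>n. simple_function borel (s n)" "\<And>n. s n ` space borel \<subseteq> E"
      "\<And>y. y \<in> space borel \<Longrightarrow> (\<lambda>n. s n y) \<longlonglongrightarrow> f y"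
    using f unfolding BSM_def by blast
  have "bounded ((\<lambda>y. f (y + x)) ` space borel)"
    by (rule bounded_subset[of "f ` space borel"]) (use f in \<open>auto simp: BSM_def\<close>)
  moreover have "(\<lambda>y. f (y + x)) ` space borel \<subseteq> E" using f by (auto simp: BSM_def)
  moreover have "s n (y + x) \<in> E" for n y using s(2)[of n] by auto
  ultimately show ?thesis
    using s(3) simple_function_shift[OF s(1)] unfolding BSM_def
    by (auto intro!: exI[of _ "\<lambda>n y. s n (y + x)"])
qed

lemma simple_integral_shift:
  fixes x :: "'x::real_normed_vector"
  shows "simple_integral_op borel (\<lambda>B F. shift_measure x \<mu> B o\<^sub>L F) A (\<lambda>y. s (y + x))
    = simple_integral_op borel (\<lambda>B F. \<mu> B o\<^sub>L F) ((\<lambda>y. y + x) ` A) s"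
proof -
  have "(\<lambda>y. s (y + x)) ` UNIV = s ` UNIV"
    using surj_plus[of x] by (metis image_image)
  moreover have "(\<lambda>y. y + x) ` (A \<inter> (\<lambda>y. s (y + x)) -` {v}) = (\<lambda>y. y + x) ` A \<inter> s -` {v}" for v
    by auto
  ultimately show ?thesis by (simp add: simple_integral_op_def shift_measure_def)
qed

lemma measure_mult_shift:
  fixes x :: "'x::real_normed_vector"
  assumes "operator_module Y LV" and \<mu>: "\<mu> \<in> CCA borel Y" and \<phi>: "\<phi> \<in> BSM borel LV"
  shows "shift_measure x (measure_mult borel LV \<mu> \<phi>)
    = measure_mult borel LV (shift_measure x \<mu>) (\<lambda>y. \<phi> (y + x))"
proof
  fix A
  interpret operator_module borel Y LV by fact
  show "shift_measure x (measure_mult borel LV \<mu> \<phi>) A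
    = measure_mult borel LV (shift_measure x \<mu>) (\<lambda>y. \<phi> (y + x)) A"
  proof (cases "A \<in> sets borel")
    case True
    obtain s C where s: "\<And>n. simple_function borel (s n)" "\<And>n. s n ` space borel \<subseteq> LV"
      "\<And>n y. y \<in> space borel \<Longrightarrow> norm (s n y) \<le> C" "\<And>y. y \<in> space borel \<Longrightarrow> (\<lambda>n. s n y) \<longlonglongrightarrow> \<phi> y"
      using BSM_bounded_approx[OF \<phi> subspace_0[OF subspace_LV]] by blast
    have "(\<lambda>n. simple_integral_op borel (\<lambda>B F. shift_measure x \<mu> B o\<^sub>L F) A (\<lambda>y. s n (y + x)))
        \<longlonglongrightarrow> measure_mult borel LV (shift_measure x \<mu>) (\<lambda>y. \<phi> (y + x)) A"
    proof (rule measure_mult_tendsto[OF CCA_shift[OF \<mu>] _ _ _ _ _ True])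
      show "simple_function borel (\<lambda>y. s n (y + x))" for n using s(1) by (rule simple_function_shift)
      show "(\<lambda>y. \<phi> (y + x)) ` space borel \<subseteq> LV" using BSM_shift[OF \<phi>] by (rule BSM_image)
      show "norm (s n (y + x)) \<le> C" for n y using s(3) by simp
      show "(\<lambda>y. s n (y + x)) ` space borel \<subseteq> LV" for n using s(2)[of n] by auto
    qed (use s in auto)
    moreover have "(\<lambda>n. simple_integral_op borel (\<lambda>B F. \<mu> B o\<^sub>L F) ((\<lambda>y. y + x) ` A) (s n))
        \<longlonglongrightarrow> measure_mult borel LV \<mu> \<phi> ((\<lambda>y. y + x) ` A)"
      using True image_plus_sets_borel by (intro measure_mult_tendsto[OF \<mu> s BSM_image[OF \<phi>]]) auto
    ultimately show ?thesis
      unfolding simple_integral_shift by (simp add: shift_measure_def LIMSEQ_unique)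
  qed (simp add: measure_mult_outside shift_measure_def image_plus_sets_borel)
qed

section \<open>Operators over the scalar field\<close>

context normed_space_over
begin

lemma of_real_mem: "complex_of_real r \<in> K"
  using scalar_field by auto

lemma bounded_linear_scale:
  assumes c: "c \<in> K"
  shows "bounded_linear (scale c)"
proof (rule bounded_linear_intro[where K = "cmod c"])
  show "scale c (r *\<^sub>R x) = r *\<^sub>R scale c x" for r x
    using scale_scale[OF c of_real_mem[of r], of x] scale_scale[OF of_real_mem[of r] c, of x]
    by (simp add: scale_of_real mult.commute)
qed (use c in \<open>auto simp: scale_right_distrib norm_scale mult.commute\<close>)

end

lemma operator_module_bounded_ops:
  fixes sV :: "complex \<Rightarrow> 'v::real_normed_vector \<Rightarrow> 'v" and sW :: "complex \<Rightarrow> 'w::banach \<Rightarrow> 'w"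
  assumes V: "normed_space_over K sV" and W: "normed_space_over K sW"
  shows "operator_module (bounded_ops K sV sW) (bounded_ops K sV sV)"
proof
  have sub: "subspace (bounded_ops K sV sU)" if U: "normed_space_over K sU"
    for sU :: "complex \<Rightarrow> 'u::real_normed_vector \<Rightarrow> 'u"
    using linear_simps[OF normed_space_over.bounded_linear_scale[OF U]]
    by (auto simp: subspace_def bounded_ops_def blinfun.add_left blinfun.scaleR_left)
  show "subspace (bounded_ops K sV sW)" "subspace (bounded_ops K sV sV)"
    using sub V W by auto
  have "closed {T :: 'v \<Rightarrow>\<^sub>L 'w. T (sV c v) = sW c (T v)}" if "c \<in> K" for c v
    by (intro closed_Collect_eq continuous_intros
        bounded_linear.continuous_on[OF normed_space_over.bounded_linear_scale[OF W that]])
  then have "closed (\<Inter>c\<in>K. \<Inter>v. {T :: 'v \<Rightarrow>\<^sub>L 'w. T (sV c v) = sW c (T v)})"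
    by (intro closed_INT ballI) auto
  moreover have "bounded_ops K sV sW = (\<Inter>c\<in>K. \<Inter>v. {T :: 'v \<Rightarrow>\<^sub>L 'w. T (sV c v) = sW c (T v)})"
    by (auto simp: bounded_ops_def)
  ultimately show "closed (bounded_ops K sV sW)" by simp
qed (auto simp: bounded_ops_def)

section \<open>Fomin derivatives\<close>

lemma has_fomin_deriv_at_translate:
  assumes "has_fomin_deriv_at Y h 0 \<mu> \<nu>"
  shows "has_fomin_deriv_at Y h x \<mu> (shift_measure x \<nu>)"
proof -
  have "(\<lambda>A. (shift_measure (x + t *\<^sub>R h) \<mu> A - shift_measure x \<mu> A) /\<^sub>R t - shift_measure x \<nu> A)
    = shift_measure x (\<lambda>A. (shift_measure (0 + t *\<^sub>R h) \<mu> A - shift_measure 0 \<mu> A) /\<^sub>R t - \<nu> A)" for t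
    by (simp add: shift_measure_def fun_eq_iff image_image add.assoc)
  then show ?thesis
    using assms by (simp only: has_fomin_deriv_at_def sv_norm_shift CA_shift)
qed

lemma sv_norm_eq_0_imp:
  assumes "sv_norm M \<mu> = 0" "A \<in> sets M"
  shows "\<mu> A = 0"
  using norm_le_op_semivariation[OF assms(2) sets.sets_into_space[OF assms(2)], of \<mu>] assms(1)
  by (simp add: sv_norm_def)

lemma has_fomin_deriv_at_unique:
  assumes \<nu>: "has_fomin_deriv_at Y h x \<mu> \<nu>" and \<nu>': "has_fomin_deriv_at Y h x \<mu> \<nu>'"
  shows "\<nu> = \<nu>'"
proof
  fix A
  define R where "R t A = (shift_measure (x + t *\<^sub>R h) \<mu> A - shift_measure x \<mu> A) /\<^sub>R t" for t A
  have "sv_norm borel (\<lambda>A. \<nu> A - \<nu>' A) \<le> sv_norm borel (\<lambda>A. R t A - \<nu>' A) + sv_norm borel (\<lambda>A. R t A - \<nu> A)" for t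
    using op_semivariation_lincomb[of borel 1 "\<lambda>A. R t A - \<nu>' A" "-1" "\<lambda>A. R t A - \<nu> A" UNIV]
    by (simp add: sv_norm_def)
  moreover have "((\<lambda>t. sv_norm borel (\<lambda>A. R t A - \<nu>' A) + sv_norm borel (\<lambda>A. R t A - \<nu> A)) \<longlongrightarrow> 0 + 0) (at 0)"
    using \<nu> \<nu>' unfolding has_fomin_deriv_at_def R_def by (intro tendsto_add) auto
  ultimately have "sv_norm borel (\<lambda>A. \<nu> A - \<nu>' A) \<le> 0 + 0"
    by (intro tendsto_lowerbound[where F = "at (0::real)"]) auto
  then have "sv_norm borel (\<lambda>A. \<nu> A - \<nu>' A) = 0" by simp
  then show "\<nu> A = \<nu>' A"
    using sv_norm_eq_0_imp[of borel "\<lambda>A. \<nu> A - \<nu>' A" A] \<nu> \<nu>'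
    by (cases "A \<in> sets borel") (auto simp: has_fomin_deriv_at_def CA_def)
qed

lemma fomin_deriv_eqI:
  assumes "has_fomin_deriv_at Y h 0 \<mu> \<nu>"
  shows "fomin_deriv Y h \<mu> = \<nu>"
  unfolding fomin_deriv_def using assms has_fomin_deriv_at_unique by (blast intro: the_equality)

text \<open>
  The Fomin derivative is a limit of difference quotients in the semivariation norm, and these have
  continuous semivariation.
\<close>

lemma has_fomin_deriv_at_CCA:
  assumes \<mu>: "\<mu> \<in> CCA borel Y" and Y: "subspace Y" and \<nu>: "has_fomin_deriv_at Y h 0 \<mu> \<nu>"
  shows "\<nu> \<in> CCA borel Y"
proof -
  define R where "R t A = (1 / t) *\<^sub>R shift_measure (t *\<^sub>R h) \<mu> A + (- 1 / t) *\<^sub>R \<mu> A" for t A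
  have R: "R t \<in> CCA borel Y" for t
    unfolding R_def[abs_def] by (rule CCA_lincomb[OF CCA_shift[OF \<mu>] \<mu> Y])
  have lim: "((\<lambda>t. sv_norm borel (\<lambda>A. R t A - \<nu> A)) \<longlongrightarrow> 0) (at 0)"
    using \<nu> by (simp add: has_fomin_deriv_at_def R_def shift_measure_def[of 0] inverse_eq_divide scaleR_diff_right)
  have "(\<lambda>n. op_semivariation borel \<nu> (A n)) \<longlonglongrightarrow> 0"
    if A: "range A \<subseteq> sets borel" "decseq A" "(\<Inter>n. A n) = {}" for A :: "nat \<Rightarrow> 'a set"
  proof (rule order_tendstoI)
    fix e :: ennreal assume "e > 0"
    then obtain \<delta> :: real where \<delta>: "\<delta> > 0" "ennreal \<delta> < e" by (rule ennreal_pos_real_less)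
    have "\<forall>\<^sub>F t in at 0. sv_norm borel (\<lambda>A. R t A - \<nu> A) < ennreal (\<delta> / 2)"
      using lim \<delta> by (intro order_tendstoD(2)) auto
    then obtain t where t: "sv_norm borel (\<lambda>A. R t A - \<nu> A) < ennreal (\<delta> / 2)"
      using eventually_happens[of _ "at (0::real)"] by auto
    have "(\<lambda>n. op_semivariation borel (R t) (A n)) \<longlonglongrightarrow> 0"
      using R A by (auto simp: CCA_def continuous_semivariation_op)
    then have "\<forall>\<^sub>F n in sequentially. op_semivariation borel (R t) (A n) < ennreal (\<delta> / 2)"
      using \<delta> by (intro order_tendstoD(2)) auto
    then show "\<forall>\<^sub>F n in sequentially. op_semivariation borel \<nu> (A n) < e"
    proof eventually_elim
      case (elim n)
      have "op_semivariation borel \<nu> (A n)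
          \<le> op_semivariation borel (R t) (A n) + op_semivariation borel (\<lambda>A. R t A - \<nu> A) (A n)"
        using op_semivariation_lincomb[of borel 1 "R t" "-1" "\<lambda>A. R t A - \<nu> A" "A n"] by simp
      also have "\<dots> \<le> ennreal (\<delta> / 2) + ennreal (\<delta> / 2)"
      proof (rule add_mono)
        have "op_semivariation borel (\<lambda>A. R t A - \<nu> A) (A n) \<le> sv_norm borel (\<lambda>A. R t A - \<nu> A)"
          unfolding sv_norm_def op_semivariation_def by (rule semivariation_mono) simp
        then show "op_semivariation borel (\<lambda>A. R t A - \<nu> A) (A n) \<le> ennreal (\<delta> / 2)" using t by simp
      qed (use elim in simp)
      also have "\<dots> = ennreal \<delta>" using \<delta> by (simp flip: ennreal_plus)
      finally show ?case using \<delta> by simp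
    qed
  qed simp
  then show ?thesis using \<nu> by (simp add: CCA_def continuous_semivariation_op has_fomin_deriv_at_def)
qed

section \<open>The product rule\<close>

lemma dir_deriv_eqI:
  assumes "has_dir_deriv h f x D"
  shows "dir_deriv h f x = D"
  unfolding dir_deriv_def
proof (rule the_equality[where a = D])
  show "D' = D" if "has_dir_deriv h f x D'" for D'
    using that assms tendsto_unique[of "at (0::real)"] unfolding has_dir_deriv_def by auto
qed fact

lemma dir_deriv_mean_value:
  assumes deriv: "\<And>x. has_dir_deriv h f x (f' x)" and C: "\<And>x. norm (f' x) \<le> C"
  shows "norm (f (x + t *\<^sub>R h) - f x) \<le> C * \<bar>t\<bar>"
proof -
  let ?g = "\<lambda>s. f (x + s *\<^sub>R h)"
  have "(?g has_derivative (\<lambda>t. t *\<^sub>R f' (x + s *\<^sub>R h))) (at s)" for s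
    unfolding has_derivative_at
  proof
    let ?D = "f' (x + s *\<^sub>R h)"
    show "bounded_linear (\<lambda>t. t *\<^sub>R ?D)" by (rule bounded_linear_scaleR_left)
    have "((\<lambda>t. (f (x + s *\<^sub>R h + t *\<^sub>R h) - f (x + s *\<^sub>R h)) /\<^sub>R t - ?D) \<longlongrightarrow> 0) (at 0)"
      using deriv[of "x + s *\<^sub>R h"] by (simp add: has_dir_deriv_def LIM_zero)
    then have "((\<lambda>t. norm ((f (x + s *\<^sub>R h + t *\<^sub>R h) - f (x + s *\<^sub>R h)) /\<^sub>R t - ?D)) \<longlongrightarrow> 0) (at 0)"
      by (rule tendsto_norm_zero)
    then show "((\<lambda>t. norm (?g (s + t) - ?g s - t *\<^sub>R ?D) / norm t) \<longlongrightarrow> 0) (at 0)"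
    proof (rule Lim_transform_eventually)
      have "norm ((f (x + s *\<^sub>R h + t *\<^sub>R h) - f (x + s *\<^sub>R h)) /\<^sub>R t - ?D)
          = norm (?g (s + t) - ?g s - t *\<^sub>R ?D) / norm t" if "t \<noteq> 0" for t
      proof -
        have "(f (x + s *\<^sub>R h + t *\<^sub>R h) - f (x + s *\<^sub>R h)) /\<^sub>R t - ?D
            = (?g (s + t) - ?g s - t *\<^sub>R ?D) /\<^sub>R t"
          using that by (simp add: scaleR_add_left add.assoc scaleR_diff_right)
        then show ?thesis by (simp add: divide_inverse mult.commute)
      qed
      then show "\<forall>\<^sub>F t in at 0. norm ((f (x + s *\<^sub>R h + t *\<^sub>R h) - f (x + s *\<^sub>R h)) /\<^sub>R t - ?D)
          = norm (?g (s + t) - ?g s - t *\<^sub>R ?D) / norm t"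
        by (auto simp: eventually_at intro: exI[of _ 1])
    qed
  qed
  moreover have "onorm (\<lambda>t::real. t *\<^sub>R f' (x + s *\<^sub>R h)) \<le> C" for s
    using mult_right_mono[OF C[of "x + s *\<^sub>R h"] abs_ge_zero] by (intro onorm_le) (simp add: mult.commute)
  ultimately have "norm (?g t - ?g 0) \<le> C * norm (t - 0)"
    by (intro differentiable_bound[of UNIV ?g "\<lambda>s t. t *\<^sub>R f' (x + s *\<^sub>R h)"]) auto
  then show ?thesis by simp
qed

theorem has_fomin_deriv_at_measure_mult:
  fixes h :: "'x::real_normed_vector" and \<phi> :: "'x \<Rightarrow> 'v::real_normed_vector \<Rightarrow>\<^sub>L 'v"
    and Y :: "('v \<Rightarrow>\<^sub>L 'w::banach) set"
  assumes module: "operator_module Y LV"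
    and \<mu>: "\<mu> \<in> CCA borel Y" and \<nu>: "has_fomin_deriv_at Y h 0 \<mu> \<nu>"
    and \<phi>: "\<phi> \<in> BSM borel LV" and \<psi>: "\<psi> \<in> BSM borel LV"
    and deriv: "\<And>x. has_dir_deriv h \<phi> x (\<psi> x)"
  shows "has_fomin_deriv_at Y h 0 (measure_mult borel LV \<mu> \<phi>)
    (\<lambda>A. measure_mult borel LV \<nu> \<phi> A + measure_mult borel LV \<mu> \<psi> A)"
proof -
  interpret operator_module borel Y LV by fact
  let ?mm = "measure_mult borel LV"
  have \<nu>_CCA: "\<nu> \<in> CCA borel Y" by (rule has_fomin_deriv_at_CCA[OF \<mu> subspace_Y \<nu>])
  obtain C where C: "0 \<le> C" "\<And>x. norm (\<phi> x) \<le> C" using BSM_bound[OF \<phi>] by auto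
  obtain C' where C': "0 \<le> C'" "\<And>x. norm (\<psi> x) \<le> C'" using BSM_bound[OF \<psi>] by auto
  have mv: "norm (\<phi> (x + t *\<^sub>R h) - \<phi> x) \<le> C' * \<bar>t\<bar>" for x t
    by (rule dir_deriv_mean_value[OF deriv C'(2)])
  define \<mu>t where "\<mu>t t = shift_measure (t *\<^sub>R h) \<mu>" for t :: real
  define \<phi>t where "\<phi>t t = (\<lambda>x. \<phi> (x + t *\<^sub>R h))" for t :: real
  \<comment> \<open>The primed objects are the errors of the difference quotients of \<open>\<mu>\<close> and \<open>\<phi>\<close>, and \<open>\<delta>\<close> is the
      increment of \<open>\<phi>\<close>.\<close>
  define \<rho> where "\<rho> t = (\<lambda>A. (1/t) *\<^sub>R \<mu>t t A + (-1/t) *\<^sub>R \<mu> A)" for t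
  define \<rho>' where "\<rho>' t = (\<lambda>A. 1 *\<^sub>R \<rho> t A + (-1) *\<^sub>R \<nu> A)" for t
  define \<delta> where "\<delta> t = (\<lambda>x. 1 *\<^sub>R \<phi>t t x + (-1) *\<^sub>R \<phi> x)" for t
  define \<kappa> where "\<kappa> t = (\<lambda>x. (1/t) *\<^sub>R \<phi>t t x + (-1/t) *\<^sub>R \<phi> x)" for t
  define \<kappa>' where "\<kappa>' t = (\<lambda>x. 1 *\<^sub>R \<kappa> t x + (-1) *\<^sub>R \<psi> x)" for t
  have \<mu>t: "\<mu>t t \<in> CCA borel Y" for t unfolding \<mu>t_def by (rule CCA_shift[OF \<mu>])
  have \<rho>: "\<rho> t \<in> CCA borel Y" for t unfolding \<rho>_def by (rule CCA_lincomb[OF \<mu>t \<mu> subspace_Y])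
  have \<rho>': "\<rho>' t \<in> CCA borel Y" for t unfolding \<rho>'_def by (rule CCA_lincomb[OF \<rho> \<nu>_CCA subspace_Y])
  have \<phi>t: "\<phi>t t \<in> BSM borel LV" for t unfolding \<phi>t_def by (rule BSM_shift[OF \<phi>])
  have \<delta>: "\<delta> t \<in> BSM borel LV" for t unfolding \<delta>_def by (rule BSM_lincomb[OF \<phi>t \<phi> subspace_LV])
  have \<kappa>: "\<kappa> t \<in> BSM borel LV" for t unfolding \<kappa>_def by (rule BSM_lincomb[OF \<phi>t \<phi> subspace_LV])
  have \<kappa>': "\<kappa>' t \<in> BSM borel LV" for t unfolding \<kappa>'_def by (rule BSM_lincomb[OF \<kappa> \<psi> subspace_LV])
  have shift: "shift_measure (t *\<^sub>R h) (?mm \<mu> \<phi>) = ?mm (\<mu>t t) (\<phi>t t)" for t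
    unfolding \<mu>t_def \<phi>t_def by (rule measure_mult_shift[OF module \<mu> \<phi>])
  \<comment> \<open>Scalars \<open>1\<close> and \<open>-1\<close> are kept so that the linearity lemmas apply verbatim.\<close>
  have decomp: "(shift_measure (0 + t *\<^sub>R h) (?mm \<mu> \<phi>) A - shift_measure 0 (?mm \<mu> \<phi>) A) /\<^sub>R t
        - (?mm \<nu> \<phi> A + ?mm \<mu> \<psi> A)
      = 1 *\<^sub>R (1 *\<^sub>R ?mm (\<rho>' t) (\<phi>t t) A + 1 *\<^sub>R ?mm \<nu> (\<delta> t) A) + 1 *\<^sub>R ?mm \<mu> (\<kappa>' t) A" for t A
  proof -
    have "?mm (\<rho>' t) (\<phi>t t) A = 1 *\<^sub>R ?mm (\<rho> t) (\<phi>t t) A + (-1) *\<^sub>R ?mm \<nu> (\<phi>t t) A"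
      unfolding \<rho>'_def by (rule measure_mult_lincomb_left[OF \<rho> \<nu>_CCA \<phi>t])
    moreover have "?mm (\<rho> t) (\<phi>t t) A = (1/t) *\<^sub>R ?mm (\<mu>t t) (\<phi>t t) A + (-1/t) *\<^sub>R ?mm \<mu> (\<phi>t t) A"
      unfolding \<rho>_def by (rule measure_mult_lincomb_left[OF \<mu>t \<mu> \<phi>t])
    moreover have "?mm \<nu> (\<delta> t) A = 1 *\<^sub>R ?mm \<nu> (\<phi>t t) A + (-1) *\<^sub>R ?mm \<nu> \<phi> A"
      unfolding \<delta>_def by (rule measure_mult_lincomb_right[OF \<nu>_CCA \<phi>t \<phi>])
    moreover have "?mm \<mu> (\<kappa>' t) A = 1 *\<^sub>R ?mm \<mu> (\<kappa> t) A + (-1) *\<^sub>R ?mm \<mu> \<psi> A"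
      unfolding \<kappa>'_def by (rule measure_mult_lincomb_right[OF \<mu> \<kappa> \<psi>])
    moreover have "?mm \<mu> (\<kappa> t) A = (1/t) *\<^sub>R ?mm \<mu> (\<phi>t t) A + (-1/t) *\<^sub>R ?mm \<mu> \<phi> A"
      unfolding \<kappa>_def by (rule measure_mult_lincomb_right[OF \<mu> \<phi>t \<phi>])
    ultimately show ?thesis
      by (simp add: shift shift_measure_def[of 0] scaleR_diff_right inverse_eq_divide)
  qed
  have lim: "(\<lambda>n. sv_norm borel (\<lambda>A. (shift_measure (0 + X n *\<^sub>R h) (?mm \<mu> \<phi>) A
        - shift_measure 0 (?mm \<mu> \<phi>) A) /\<^sub>R X n - (?mm \<nu> \<phi> A + ?mm \<mu> \<psi> A))) \<longlonglongrightarrow> 0"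
    if X: "\<And>n::nat. X n \<noteq> 0" "X \<longlonglongrightarrow> 0" for X :: "nat \<Rightarrow> real"
  proof -
    have X_at: "filterlim X (at 0) sequentially" using X by (simp add: filterlim_at)
    have bound: "sv_norm borel (\<lambda>A. (shift_measure (0 + X n *\<^sub>R h) (?mm \<mu> \<phi>) A
          - shift_measure 0 (?mm \<mu> \<phi>) A) /\<^sub>R X n - (?mm \<nu> \<phi> A + ?mm \<mu> \<psi> A))
        \<le> ennreal C * sv_norm borel (\<rho>' (X n)) + sv_norm borel (?mm \<nu> (\<delta> (X n))) + sv_norm borel (?mm \<mu> (\<kappa>' (X n)))" for n
    proof -
      let ?a = "?mm (\<rho>' (X n)) (\<phi>t (X n))" and ?b = "?mm \<nu> (\<delta> (X n))" and ?c = "?mm \<mu> (\<kappa>' (X n))"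
      have "sv_norm borel (\<lambda>A. 1 *\<^sub>R (1 *\<^sub>R ?a A + 1 *\<^sub>R ?b A) + 1 *\<^sub>R ?c A)
          \<le> sv_norm borel (\<lambda>A. 1 *\<^sub>R ?a A + 1 *\<^sub>R ?b A) + sv_norm borel ?c"
        using op_semivariation_lincomb[of borel 1 "\<lambda>A. 1 *\<^sub>R ?a A + 1 *\<^sub>R ?b A" 1 ?c UNIV] by (simp add: sv_norm_def)
      also have "sv_norm borel (\<lambda>A. 1 *\<^sub>R ?a A + 1 *\<^sub>R ?b A) \<le> sv_norm borel ?a + sv_norm borel ?b"
        using op_semivariation_lincomb[of borel 1 ?a 1 ?b UNIV] by (simp add: sv_norm_def)
      also have "sv_norm borel ?a \<le> ennreal C * sv_norm borel (\<rho>' (X n))"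
        unfolding sv_norm_def using C by (intro op_semivariation_measure_mult_le[OF \<rho>' \<phi>t]) (auto simp: \<phi>t_def)
      finally show ?thesis unfolding decomp by (simp add: add_mono)
    qed
    have "(\<lambda>n. sv_norm borel (\<rho>' (X n))) \<longlonglongrightarrow> 0"
    proof -
      have "((\<lambda>t. sv_norm borel (\<rho>' t)) \<longlongrightarrow> 0) (at 0)"
        using \<nu> by (simp add: has_fomin_deriv_at_def \<rho>'_def \<rho>_def \<mu>t_def shift_measure_def[of 0]
            scaleR_diff_right inverse_eq_divide)
      then show ?thesis using X_at by (rule filterlim_compose)
    qed
    moreover have "(\<lambda>n. sv_norm borel (?mm \<nu> (\<delta> (X n)))) \<longlonglongrightarrow> 0"
    proof (rule measure_mult_dominated_convergence[OF \<nu>_CCA \<delta>, where C = "2 * C"])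
      show "norm (\<delta> (X n) x) \<le> 2 * C" for n x
        using norm_triangle_ineq4[of "\<phi> (x + X n *\<^sub>R h)" "\<phi> x"] C(2)[of "x + X n *\<^sub>R h"] C(2)[of x]
        by (simp add: \<delta>_def \<phi>t_def)
      show "(\<lambda>n. \<delta> (X n) x) \<longlonglongrightarrow> 0" for x
      proof (rule Lim_null_comparison)
        show "\<forall>\<^sub>F n in sequentially. norm (\<delta> (X n) x) \<le> C' * \<bar>X n\<bar>"
          using mv by (simp add: \<delta>_def \<phi>t_def)
        show "(\<lambda>n. C' * \<bar>X n\<bar>) \<longlonglongrightarrow> 0" using tendsto_mult_right_zero[OF tendsto_rabs_zero[OF X(2)]] .
      qed
    qed (use C in simp)
    moreover have "(\<lambda>n. sv_norm borel (?mm \<mu> (\<kappa>' (X n)))) \<longlonglongrightarrow> 0"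
    proof (rule measure_mult_dominated_convergence[OF \<mu> \<kappa>', where C = "2 * C'"])
      have \<kappa>_eq: "\<kappa> t x = (\<phi> (x + t *\<^sub>R h) - \<phi> x) /\<^sub>R t" for t x
        by (simp add: \<kappa>_def \<phi>t_def scaleR_diff_right inverse_eq_divide)
      show "norm (\<kappa>' (X n) x) \<le> 2 * C'" for n x
      proof -
        have "norm (\<kappa> (X n) x) \<le> C'"
        proof -
          have "norm (\<kappa> (X n) x) = norm (\<phi> (x + X n *\<^sub>R h) - \<phi> x) / \<bar>X n\<bar>"
            by (simp add: \<kappa>_eq divide_inverse mult.commute)
          then show ?thesis using mv[of x "X n"] X(1)[of n] by (simp add: pos_divide_le_eq)
        qed
        then show ?thesis
          using norm_triangle_ineq4[of "\<kappa> (X n) x" "\<psi> x"] C'(2)[of x] by (simp add: \<kappa>'_def)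
      qed
      show "(\<lambda>n. \<kappa>' (X n) x) \<longlonglongrightarrow> 0" for x
      proof -
        have "((\<lambda>t. \<kappa> t x) \<longlongrightarrow> \<psi> x) (at 0)" using deriv[of x] by (simp add: has_dir_deriv_def \<kappa>_eq)
        then have "(\<lambda>n. \<kappa> (X n) x) \<longlonglongrightarrow> \<psi> x" using X_at by (rule filterlim_compose)
        then show ?thesis by (simp add: \<kappa>'_def LIM_zero)
      qed
    qed (use C' in simp)
    ultimately have upper: "(\<lambda>n. ennreal C * sv_norm borel (\<rho>' (X n)) + sv_norm borel (?mm \<nu> (\<delta> (X n)))
        + sv_norm borel (?mm \<mu> (\<kappa>' (X n)))) \<longlonglongrightarrow> 0 + 0 + 0"
      by (intro tendsto_add tendsto_cmult_ennreal_0)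
    show ?thesis
    proof (rule tendsto_sandwich[OF _ _ tendsto_const])
      show "(\<lambda>n. ennreal C * sv_norm borel (\<rho>' (X n)) + sv_norm borel (?mm \<nu> (\<delta> (X n)))
          + sv_norm borel (?mm \<mu> (\<kappa>' (X n)))) \<longlonglongrightarrow> 0"
        using upper by simp
    qed (use bound in \<open>simp_all add: always_eventually\<close>)
  qed
  have "(\<lambda>A. ?mm \<nu> \<phi> A + ?mm \<mu> \<psi> A) \<in> CA borel Y"
    using CCA_lincomb[OF measure_mult_CCA[OF \<nu>_CCA \<phi>] measure_mult_CCA[OF \<mu> \<psi>] subspace_Y, of 1 1]
    by (simp add: CCA_def)
  then show ?thesis
    unfolding has_fomin_deriv_at_def tendsto_at_iff_sequentially o_def using lim by blast
qed

theorem theorem3p4p1: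
  fixes K :: "complex set"
    and sV :: "complex \<Rightarrow> 'v::banach \<Rightarrow> 'v"
    and sW :: "complex \<Rightarrow> 'w::banach \<Rightarrow> 'w"
    and h :: "real ^ 'd"
    and \<mu> :: "(real ^ 'd) set \<Rightarrow> 'v \<Rightarrow>\<^sub>L 'w"
    and \<phi> :: "real ^ 'd \<Rightarrow> 'v \<Rightarrow>\<^sub>L 'v"
  defines "LVW \<equiv> bounded_ops K sV sW"
    and "LV \<equiv> bounded_ops K sV sV"
  assumes "normed_space_over K sV"
    and "normed_space_over K sW"
    and "\<mu> \<in> CA borel LVW"
    and "\<mu> \<in> fomin_differentiable LVW h"
    and "continuous_semivariation borel UNIV (\<lambda>A. blinfun_apply (\<mu> A))"
    and "\<forall>x. \<exists>D. has_dir_deriv h \<phi> x D"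
    and "\<phi> \<in> BSM borel LV"
    and "dir_deriv h \<phi> \<in> BSM borel LV"
  shows "measure_mult borel LV \<mu> \<phi> \<in> fomin_differentiable LVW h \<and>
    fomin_deriv LVW h (measure_mult borel LV \<mu> \<phi>) =
      (\<lambda>A. measure_mult borel LV (fomin_deriv LVW h \<mu>) \<phi> A
         + measure_mult borel LV \<mu> (dir_deriv h \<phi>) A)"
proof -
  interpret operator_module borel LVW LV
    unfolding LVW_def LV_def by (rule operator_module_bounded_ops) fact+
  have \<mu>: "\<mu> \<in> CCA borel LVW" using assms by (simp add: CCA_def)
  obtain \<nu> where \<nu>: "has_fomin_deriv_at LVW h 0 \<mu> \<nu>"
    using \<open>\<mu> \<in> fomin_differentiable LVW h\<close> by (auto simp: fomin_differentiable_def)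
  have deriv: "has_dir_deriv h \<phi> x (dir_deriv h \<phi> x)" for x
    using \<open>\<forall>x. \<exists>D. has_dir_deriv h \<phi> x D\<close> dir_deriv_eqI by metis
  let ?D = "\<lambda>A. measure_mult borel LV \<nu> \<phi> A + measure_mult borel LV \<mu> (dir_deriv h \<phi>) A"
  have D: "has_fomin_deriv_at LVW h 0 (measure_mult borel LV \<mu> \<phi>) ?D"
    by (rule has_fomin_deriv_at_measure_mult[OF operator_module_axioms \<mu> \<nu> _ _ deriv]) fact+
  have "measure_mult borel LV \<mu> \<phi> \<in> CA borel LVW"
    using measure_mult_CCA[OF \<mu> \<open>\<phi> \<in> BSM borel LV\<close>] by (simp add: CCA_def)
  then have "measure_mult borel LV \<mu> \<phi> \<in> fomin_differentiable LVW h"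
    using has_fomin_deriv_at_translate[OF D] by (auto simp: fomin_differentiable_def)
  then show ?thesis
    by (simp add: fomin_deriv_eqI[OF D] fomin_deriv_eqI[OF \<nu>])
qed

end
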